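(* Let $\Omega\subset\mathbb{R}^n$ be a bounded domain with smooth boundary, $\Gamma\subset\partial\Omega$ a subboundary, $x_0\in\Gamma$, $T>0$, $\delta_0>0$, $M>0$, and $p\in C(\overline{\Omega})$ fixed, and let $\mathcal{H}$ be the admissible set of vector fields defined in the context. Let $a_1,\dots,a_n\in C^1(\overline\Omega)$ satisfy $$|\det(\nabla a_1(x),\dots,\nabla a_n(x))|\neq 0,\qquad x\in\overline{\Omega}.$$ Then there exists a subdomain $D\subset\Omega$ with $x_0\in\partial D\cap\partial\Omega\subset\Gamma$ such that the following holds: if $H_1,H_2\in\mathcal{H}$ and $u(H_j,a_k)$, $j=1,2$, $k=1,\dots,n$, are solutions with $\partial_tu(H_j,a_k)\in C^1(\overline\Omega\times[0,T])$ satisfying $$u(H_1,a_k)|_{\Gamma\times(0,T)}=u(H_2,a_k)|_{\Gamma\times(0,T)},\qquad k=1,2,\dots,n,$$ then $H_1(x)=H_2(x)$ for all $x\in D$.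
   Context: A subboundary means a nonempty relatively open subset of $\partial\Omega$. $(x\cdot y)$ is the Euclidean scalar product, $|x|$ the Euclidean norm, $\nabla$ is the gradient in $x$ (a column vector), and $\nu(x)$ is the outward unit normal to $\partial\Omega$ at $x$. Admissible set: $$\mathcal{H}=\{H\in (C^1(\overline\Omega))^n:\ \|H\|_{(C^1(\overline\Omega))^n}\le M,\ (H(x_0)\cdot\nu(x_0))>\delta_0,\ |H(x)|>\delta_0\ \text{for } x\in\Omega\},$$ where for $H=(h_1,\dots,h_n)$ one may take $\|H\|_{(C^1(\overline\Omega))^n}=\max_{\overline\Omega}|H|+\max_{\overline\Omega}\big(\sum_{j,k}|\partial_kh_j|^2\big)^{1/2}$. For $H\in\mathcal{H}$ and $a\in C^1(\overline\Omega)$, $u(H,a)$ denotes one arbitrarily chosen solution $u\in C^1(\overline\Omega\times[0,T])$ of $$\partial_tu+(H(x)\cdot\nabla u)+p(x)u=0\ \text{ in }\Omega\times(0,T),\qquad u(x,0)=a(x),\ x\in\Omega.$$ No boundary condition is imposed, so there are in general many such solutions. *)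

theory Defs
  imports "HOL-Analysis.Analysis"
begin

text \<open>The space \<open>C\<^sup>1\<close> of the closure of an open set \<open>S\<close>: continuous functions on the closure
  that are differentiable in \<open>S\<close> and whose gradient extends continuously to the closure.
  Values of a function outside the closure are irrelevant.\<close>

definition is_grad_on :: "'a::euclidean_space set \<Rightarrow> ('a \<Rightarrow> real) \<Rightarrow> ('a \<Rightarrow> 'a) \<Rightarrow> bool" where
  "is_grad_on S f g \<longleftrightarrow>
     continuous_on (closure S) g \<and> (\<forall>x\<in>S. GDERIV f x :> g x)"

definition C1_closure :: "'a::euclidean_space set \<Rightarrow> ('a \<Rightarrow> real) \<Rightarrow> bool" where
  "C1_closure S f \<longleftrightarrow> continuous_on (closure S) f \<and> (\<exists>g. is_grad_on S f g)"

text \<open>The gradient, extended continuously to the closure of \<open>S\<close>; the choice is unique there by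
  \<open>grad_on_eq\<close>.\<close>

definition grad_on :: "'a::euclidean_space set \<Rightarrow> ('a \<Rightarrow> real) \<Rightarrow> 'a \<Rightarrow> 'a" where
  "grad_on S f = (SOME g. is_grad_on S f g)"

lemma gderiv_unique:
  assumes "GDERIV f x :> a" "GDERIV f x :> b"
  shows "a = b"
proof -
  have "(\<lambda>h. h \<bullet> a) = (\<lambda>h. h \<bullet> b)"
    using assms has_derivative_unique unfolding gderiv_def by blast
  then have "h \<bullet> a = h \<bullet> b" for h
    by (rule fun_cong)
  then show ?thesis
    using vector_eq_ldot[of a b] by simp
qed

lemma grad_on_eq:
  assumes g: "is_grad_on S f g" and x: "x \<in> closure S"
  shows "grad_on S f x = g x"
proof -
  have g': "is_grad_on S f (grad_on S f)"
    unfolding grad_on_def using g someI[of "is_grad_on S f" g] by simp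
  have cont: "continuous_on (closure S) (\<lambda>y. grad_on S f y - g y)"
    using g g' unfolding is_grad_on_def by (intro continuous_intros) auto
  have "\<And>y. y \<in> S \<Longrightarrow> grad_on S f y - g y = 0"
    using g g' gderiv_unique unfolding is_grad_on_def by (metis right_minus_eq)
  then have "grad_on S f x - g x = 0"
    using continuous_constant_on_closure[OF cont _ x, of 0] by blast
  then show ?thesis by simp
qed

primrec Ck_on :: "nat \<Rightarrow> 'a::euclidean_space set \<Rightarrow> ('a \<Rightarrow> real) \<Rightarrow> bool" where
  "Ck_on 0 U f \<longleftrightarrow> continuous_on U f"
| "Ck_on (Suc k) U f \<longleftrightarrow>
     (\<exists>g. (\<forall>x\<in>U. GDERIV f x :> g x) \<and> (\<forall>b\<in>Basis. Ck_on k U (\<lambda>x. g x \<bullet> b)))"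

definition smooth_on :: "'a::euclidean_space set \<Rightarrow> ('a \<Rightarrow> real) \<Rightarrow> bool" where
  "smooth_on U f \<longleftrightarrow> (\<forall>k. Ck_on k U f)"

text \<open>A smooth function \<open>\<rho>\<close> without critical points such that, in the neighbourhood \<open>U\<close> of \<open>x\<close>,
  the set \<open>S\<close> is \<open>{\<rho> < 0}\<close>. If \<open>x\<close> is a boundary point of the open set \<open>S\<close>, then
  \<open>\<rho> x = 0\<close>, the boundary of \<open>S\<close> in \<open>U\<close> is the hypersurface \<open>{\<rho> = 0}\<close>, and \<open>S\<close> lies on one side
  of it.\<close>

definition local_defining_function ::
  "'a::euclidean_space set \<Rightarrow> 'a \<Rightarrow> 'a set \<Rightarrow> ('a \<Rightarrow> real) \<Rightarrow> bool" where
  "local_defining_function S x U \<rho> \<longleftrightarrow>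
     open U \<and> x \<in> U \<and> smooth_on U \<rho> \<and> (\<forall>y\<in>U. \<not> (GDERIV \<rho> y :> 0)) \<and>
     S \<inter> U = {y \<in> U. \<rho> y < 0}"

definition smooth_boundary :: "'a::euclidean_space set \<Rightarrow> bool" where
  "smooth_boundary S \<longleftrightarrow> (\<forall>x\<in>frontier S. \<exists>U \<rho>. local_defining_function S x U \<rho>)"

definition bounded_smooth_domain :: "'a::euclidean_space set \<Rightarrow> bool" where
  "bounded_smooth_domain S \<longleftrightarrow>
     open S \<and> connected S \<and> S \<noteq> {} \<and> bounded S \<and> smooth_boundary S"

text \<open>Since \<open>\<rho>\<close> is negative inside and nonnegative outside, its gradient points outwards.\<close>

definition outward_normal :: "'a::euclidean_space set \<Rightarrow> 'a \<Rightarrow> 'a" where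
  "outward_normal S x =
     (THE \<nu>. \<exists>U \<rho> g. local_defining_function S x U \<rho> \<and> GDERIV \<rho> x :> g \<and> \<nu> = g /\<^sub>R norm g)"

lemma gderiv_line:
  assumes "GDERIV \<rho> x :> g"
  shows "((\<lambda>t. \<rho> (x + t *\<^sub>R v)) has_real_derivative (v \<bullet> g)) (at 0)"
proof -
  have "((\<lambda>t::real. x + t *\<^sub>R v) has_derivative (\<lambda>t. t *\<^sub>R v)) (at 0)"
    by (auto intro!: derivative_eq_intros)
  moreover have "(\<rho> has_derivative (\<lambda>h. h \<bullet> g)) (at (x + 0 *\<^sub>R v))"
    using assms by (simp add: gderiv_def)
  ultimately have "((\<lambda>t. \<rho> (x + t *\<^sub>R v)) has_derivative (\<lambda>t. (t *\<^sub>R v) \<bullet> g)) (at 0)"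
    by (rule has_derivative_compose)
  then show ?thesis
    by (simp add: has_field_derivative_def mult_commute_abs)
qed

lemma local_defining_function_zero:
  assumes l: "local_defining_function S x U \<rho>" and S: "open S" and x: "x \<in> frontier S"
    and d: "GDERIV \<rho> x :> g"
  shows "\<rho> x = 0"
proof (rule antisym)
  have xU: "x \<in> U" and U: "open U" and SU: "S \<inter> U = {y \<in> U. \<rho> y < 0}"
    using l unfolding local_defining_function_def by auto
  have "x \<notin> S" using S x by (simp add: frontier_def interior_open)
  then show "0 \<le> \<rho> x" using xU SU by force
  show "\<rho> x \<le> 0"
  proof (rule ccontr)
    assume "\<not> \<rho> x \<le> 0"
    have "isCont \<rho> x"
      using d has_derivative_continuous unfolding gderiv_def by blast
    then have "\<forall>\<^sub>F y in nhds x. \<rho> y > 0"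
      using \<open>\<not> \<rho> x \<le> 0\<close> by (simp add: continuous_at tendsto_at_iff_tendsto_nhds order_tendstoD(1))
    then obtain V where V: "open V" "x \<in> V" "\<forall>y\<in>V. \<rho> y > 0"
      by (auto simp: eventually_nhds)
    have "(V \<inter> U) \<inter> S \<noteq> {}"
      using V U xU x open_Int_closure_eq_empty[of "V \<inter> U" S]
      by (auto simp: frontier_def open_Int)
    then obtain y where "y \<in> V" "y \<in> S \<inter> U" by blast
    with SU V(3) show False by force
  qed
qed

lemma outward_normal_eq:
  assumes l: "local_defining_function S x U \<rho>" and S: "open S" and x: "x \<in> frontier S"
    and d: "GDERIV \<rho> x :> g"
  shows "outward_normal S x = g /\<^sub>R norm g"
  unfolding outward_normal_def
proof (rule the_equality)
  show "\<exists>U \<rho> g'. local_defining_function S x U \<rho> \<and> GDERIV \<rho> x :> g' \<and> g /\<^sub>R norm g = g' /\<^sub>R norm g'"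
    using l d by blast
next
  fix \<nu> assume "\<exists>U \<rho> g. local_defining_function S x U \<rho> \<and> GDERIV \<rho> x :> g \<and> \<nu> = g /\<^sub>R norm g"
  then obtain V \<sigma> h where l': "local_defining_function S x V \<sigma>" and d': "GDERIV \<sigma> x :> h"
    and \<nu>: "\<nu> = h /\<^sub>R norm h" by blast
  define \<mu> where "\<mu> = g /\<^sub>R norm g"
  have UV: "open U" "x \<in> U" "open V" "x \<in> V"
    and SU: "S \<inter> U = {y \<in> U. \<rho> y < 0}" and SV: "S \<inter> V = {y \<in> V. \<sigma> y < 0}"
    and g0: "g \<noteq> 0" and h0: "h \<noteq> 0"
    using l l' d d' unfolding local_defining_function_def by auto
  have g: "g = norm g *\<^sub>R \<mu>" and h: "h = norm h *\<^sub>R \<nu>" and n: "norm \<mu> = 1" "norm \<nu> = 1"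
    using g0 h0 by (auto simp: \<mu>_def \<nu>)
  show "\<nu> = g /\<^sub>R norm g"
  proof (rule ccontr)
    assume "\<nu> \<noteq> g /\<^sub>R norm g"
    then have ne: "\<mu> \<noteq> \<nu>" by (simp add: \<mu>_def)
    define v where "v = \<mu> - \<nu>"
    have nn: "\<mu> \<bullet> \<mu> = 1" "\<nu> \<bullet> \<nu> = 1" using n by (auto simp: norm_eq_1)
    have "v \<bullet> v > 0" using ne by (simp add: v_def)
    then have lt: "\<mu> \<bullet> \<nu> < 1"
      using nn by (simp add: v_def inner_diff inner_commute)
    have "v \<bullet> g = v \<bullet> (norm g *\<^sub>R \<mu>)" by (rule arg_cong[OF g])
    also have "\<dots> = norm g * (v \<bullet> \<mu>)" by simp
    also have "v \<bullet> \<mu> = 1 - \<mu> \<bullet> \<nu>"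
      using nn by (simp add: v_def inner_diff_left inner_commute[of \<nu> \<mu>])
    finally have "v \<bullet> g = norm g * (1 - \<mu> \<bullet> \<nu>)" .
    then have pos: "v \<bullet> g > 0" using lt g0 by simp
    have "v \<bullet> h = v \<bullet> (norm h *\<^sub>R \<nu>)" by (rule arg_cong[OF h])
    also have "\<dots> = norm h * (v \<bullet> \<nu>)" by simp
    also have "v \<bullet> \<nu> = \<mu> \<bullet> \<nu> - 1"
      using nn by (simp add: v_def inner_diff_left inner_commute[of \<nu> \<mu>])
    finally have "v \<bullet> h = norm h * (\<mu> \<bullet> \<nu> - 1)" .
    then have neg: "v \<bullet> h < 0" using lt h0 by (simp add: mult_less_0_iff)
    obtain d1 where d1: "d1 > 0" "\<And>t. 0 < t \<Longrightarrow> t < d1 \<Longrightarrow> \<rho> (x + t *\<^sub>R v) > 0"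
      using DERIV_pos_inc_right[OF gderiv_line[OF d, of v] pos]
        local_defining_function_zero[OF l S x d] by auto
    obtain d2 where d2: "d2 > 0" "\<And>t. 0 < t \<Longrightarrow> t < d2 \<Longrightarrow> \<sigma> (x + t *\<^sub>R v) < 0"
      using DERIV_neg_dec_right[OF gderiv_line[OF d', of v] neg]
        local_defining_function_zero[OF l' S x d'] by auto
    have "((\<lambda>t. x + t *\<^sub>R v) \<longlongrightarrow> x + 0 *\<^sub>R v) (at_right 0)"
      by (intro tendsto_intros)
    then have "\<forall>\<^sub>F t in at_right 0. x + t *\<^sub>R v \<in> U \<inter> V"
      using UV by (intro topological_tendstoD) auto
    moreover have "\<forall>\<^sub>F t in at_right 0. t < min d1 d2"
      using d1(1) d2(1) by (intro order_tendstoD(2)[OF tendsto_ident_at]) auto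
    moreover have "\<forall>\<^sub>F t in at_right (0::real). 0 < t"
      by (rule eventually_at_right_less)
    ultimately have "\<forall>\<^sub>F t in at_right (0::real). False"
    proof eventually_elim
      case (elim t)
      then have "\<sigma> (x + t *\<^sub>R v) < 0" "\<not> \<rho> (x + t *\<^sub>R v) < 0"
        using d1(2)[of t] d2(2)[of t] by auto
      moreover have "x + t *\<^sub>R v \<in> U" "x + t *\<^sub>R v \<in> V" using elim by auto
      ultimately show False using SU SV by blast
    qed
    then show False by simp
  qed
qed

text \<open>The maxima are written as suprema; they are attained for a \<open>C\<^sup>1\<close> field and a bounded
  nonempty \<open>\<Omega>\<close>.\<close>

definition C1_norm :: "(real^'n) set \<Rightarrow> (real^'n \<Rightarrow> real^'n) \<Rightarrow> real" where
  "C1_norm \<Omega> H =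
     (SUP x\<in>closure \<Omega>. norm (H x)) +
     (SUP x\<in>closure \<Omega>. sqrt (\<Sum>j\<in>UNIV. \<Sum>k\<in>UNIV. \<bar>grad_on \<Omega> (\<lambda>y. H y $ j) x $ k\<bar>\<^sup>2))"

definition admissible ::
  "(real^'n) set \<Rightarrow> real^'n \<Rightarrow> real \<Rightarrow> real \<Rightarrow> (real^'n \<Rightarrow> real^'n) set" where
  "admissible \<Omega> x0 M \<delta>0 =
     {H. (\<forall>j. C1_closure \<Omega> (\<lambda>x. H x $ j)) \<and> C1_norm \<Omega> H \<le> M \<and>
         H x0 \<bullet> outward_normal \<Omega> x0 > \<delta>0 \<and> (\<forall>x\<in>\<Omega>. norm (H x) > \<delta>0)}"

abbreviation cylinder :: "(real^'n) set \<Rightarrow> real \<Rightarrow> ((real^'n) \<times> real) set" where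
  "cylinder \<Omega> T \<equiv> \<Omega> \<times> {0<..<T}"

definition grad_x :: "(real^'n) set \<Rightarrow> real \<Rightarrow> ((real^'n) \<times> real \<Rightarrow> real) \<Rightarrow> (real^'n) \<times> real \<Rightarrow> real^'n" where
  "grad_x \<Omega> T u z = fst (grad_on (cylinder \<Omega> T) u z)"

definition dt :: "(real^'n) set \<Rightarrow> real \<Rightarrow> ((real^'n) \<times> real \<Rightarrow> real) \<Rightarrow> (real^'n) \<times> real \<Rightarrow> real" where
  "dt \<Omega> T u z = snd (grad_on (cylinder \<Omega> T) u z)"

definition is_solution ::
  "(real^'n) set \<Rightarrow> real \<Rightarrow> (real^'n \<Rightarrow> real) \<Rightarrow> (real^'n \<Rightarrow> real^'n) \<Rightarrow> (real^'n \<Rightarrow> real) \<Rightarrow>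
   ((real^'n) \<times> real \<Rightarrow> real) \<Rightarrow> bool" where
  "is_solution \<Omega> T p H a u \<longleftrightarrow>
     C1_closure (cylinder \<Omega> T) u \<and>
     (\<forall>x\<in>\<Omega>. \<forall>t\<in>{0<..<T}. dt \<Omega> T u (x, t) + H x \<bullet> grad_x \<Omega> T u (x, t) + p x * u (x, t) = 0) \<and>
     (\<forall>x\<in>\<Omega>. u (x, 0) = a x)"

end

theory Submission
  imports Defs
begin

text \<open>Write \<open>f = H2 - H1\<close>, \<open>v_j = dt u_j\<close> and \<open>z = v_1 - v_2\<close>. The coefficients of the equation do
  not depend on time, so \<open>v_j\<close> solves it too (\<open>dt_equation_closed\<close>), and subtraction gives
  \<open>dt z + H1 . grad z + p z = f . grad v_2\<close>. Moreover \<open>z = 0\<close> on \<open>\<Gamma>\<close> (\<open>dt_eq_on_boundary\<close>), and the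
  two equations at time zero show \<open>z(x,0) = f(x) . grad a(x)\<close> (\<open>initial_dt\<close>). The \<open>n\<close> gradients form
  a basis, so the \<open>n\<close> functions \<open>z\<close> at time zero control \<open>f\<close> (\<open>gradient_frame_bound\<close>). It remains to
  estimate \<open>z\<close> by \<open>f\<close> with a constant that is small enough to close the circle.

  Near \<open>x0\<close> the field \<open>H1\<close> points out of the domain at a definite rate, so information about \<open>z\<close> at
  \<open>(x,0)\<close> comes from \<open>\<Gamma>\<close> within a short time along the characteristic through \<open>(x,0)\<close>. Let \<open>\<nu>\<close> be
  the outward normal at \<open>x0\<close> and \<open>\<phi>(x,t) = (x - x0) . \<nu> - \<theta> |x - x0| - c t\<close>. For small \<open>\<theta>\<close> and
  \<open>c\<close> it increases along the characteristic directions \<open>(H1 x, 1)\<close>. Since the domain lies almost on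
  one side of its tangent plane at \<open>x0\<close>, the set \<open>Q\<close> of points near \<open>x0\<close> with \<open>\<phi> \<ge> -\<epsilon>\<close> reaches
  neither the rest of the boundary nor the time \<open>T\<close>. Characteristic directions therefore point into
  \<open>Q\<close> at its points with \<open>x\<close> in \<open>\<Omega>\<close>, and \<open>z = 0\<close> at its other points. Looking at a maximum
  point of \<open>exp(s \<phi>) |z|\<close> in \<open>Q\<close> shows that this maximum is of order \<open>1/s\<close> times the maximum of
  \<open>exp(s \<phi>) |f|\<close> (\<open>weighted_maximum_principle\<close>). As \<open>f\<close> does not depend on \<open>t\<close> and \<open>\<phi>\<close> decreases
  in \<open>t\<close>, the latter maximum is attained at time zero, and a large \<open>s\<close> forces \<open>f = 0\<close>
  (\<open>vector_fields_agree\<close>).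

  The parameter \<open>s\<close> may depend on the solutions, whereas \<open>\<theta>\<close>, \<open>c\<close>, \<open>\<epsilon>\<close> and the size of the
  neighbourhood depend only on \<open>\<Omega>\<close>, \<open>\<Gamma>\<close>, \<open>x0\<close>, \<open>T\<close>, \<open>M\<close>, \<open>\<delta>0\<close> (\<open>normal_component_lower_bound\<close>).
  So \<open>D\<close> may be chosen beforehand, as a component of the intersection of \<open>\<Omega>\<close> with a small ball.\<close>

section \<open>Calculus for functions of class C1 up to the boundary\<close>

lemma gderiv_along_line:
  assumes "GDERIV f (z + t *\<^sub>R d) :> g"
  shows "((\<lambda>t. f (z + t *\<^sub>R d)) has_real_derivative d \<bullet> g) (at t)"
proof -
  have "((\<lambda>h. f ((z + t *\<^sub>R d) + h *\<^sub>R d)) has_real_derivative d \<bullet> g) (at 0)"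
    by (rule gderiv_line[OF assms])
  moreover have "(z + t *\<^sub>R d) + h *\<^sub>R d = z + (h + t) *\<^sub>R d" for h
    by (simp add: scaleR_left_distrib)
  ultimately have "((\<lambda>h. f (z + (h + t) *\<^sub>R d)) has_real_derivative d \<bullet> g) (at 0)"
    by simp
  then have "((\<lambda>t. f (z + t *\<^sub>R d)) has_real_derivative d \<bullet> g) (at (0 + t))"
    by (subst DERIV_shift)
  then show ?thesis by simp
qed

lemma line_mvt:
  fixes f :: "'a::euclidean_space \<Rightarrow> real"
  assumes h: "0 < h" and cont: "continuous_on C f"
    and C: "\<And>t. 0 \<le> t \<Longrightarrow> t \<le> h \<Longrightarrow> z + t *\<^sub>R d \<in> C"
    and grad: "\<And>t. 0 < t \<Longrightarrow> t < h \<Longrightarrow> GDERIV f (z + t *\<^sub>R d) :> g (z + t *\<^sub>R d)"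
  shows "\<exists>\<xi>. 0 < \<xi> \<and> \<xi> < h \<and> f (z + h *\<^sub>R d) - f z = h * (d \<bullet> g (z + \<xi> *\<^sub>R d))"
proof -
  have "continuous_on {0..h} (\<lambda>t. f (z + t *\<^sub>R d))"
  proof (rule continuous_on_compose2[OF cont])
    show "continuous_on {0..h} (\<lambda>t. z + t *\<^sub>R d)" by (intro continuous_intros)
    show "(\<lambda>t. z + t *\<^sub>R d) ` {0..h} \<subseteq> C" using C by auto
  qed
  moreover have "((\<lambda>t. f (z + t *\<^sub>R d)) has_derivative
      (\<lambda>y. (d \<bullet> g (z + t *\<^sub>R d)) * y)) (at t)" if "0 < t" "t < h" for t
    using gderiv_along_line[OF grad[OF that]] by (simp add: has_field_derivative_def)
  ultimately obtain \<xi> where \<xi>: "0 < \<xi>" "\<xi> < h"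
    and eq: "f (z + h *\<^sub>R d) - f (z + 0 *\<^sub>R d) = (d \<bullet> g (z + \<xi> *\<^sub>R d)) * (h - 0)"
    by (rule mvt[OF h, of "\<lambda>t. f (z + t *\<^sub>R d)" "\<lambda>t y. (d \<bullet> g (z + t *\<^sub>R d)) * y"])
  have "f (z + h *\<^sub>R d) - f z = h * (d \<bullet> g (z + \<xi> *\<^sub>R d))"
    using eq by simp
  with \<xi> show ?thesis by blast
qed

lemma gradient_bound_imp_lipschitz:
  fixes f :: "'a::euclidean_space \<Rightarrow> real"
  assumes cont: "continuous_on (closure S) f" and grad: "is_grad_on S f g"
    and bound: "\<And>x. x \<in> S \<Longrightarrow> norm (g x) \<le> L"
    and ab: "a \<in> closure S" "b \<in> closure S"
    and seg: "\<And>t. 0 < t \<Longrightarrow> t < 1 \<Longrightarrow> a + t *\<^sub>R (b - a) \<in> S"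
  shows "\<bar>f b - f a\<bar> \<le> L * norm (b - a)"
proof -
  have C: "a + t *\<^sub>R (b - a) \<in> closure S" if "0 \<le> t" "t \<le> 1" for t
    using that ab seg[of t] closure_subset[of S]
    by (cases "t = 0"; cases "t = 1") auto
  obtain \<xi> where \<xi>: "0 < \<xi>" "\<xi> < 1"
    and eq: "f (a + 1 *\<^sub>R (b - a)) - f a = 1 * ((b - a) \<bullet> g (a + \<xi> *\<^sub>R (b - a)))"
    using line_mvt[of 1 "closure S" f a "b - a" g] cont C grad seg
    by (auto simp: is_grad_on_def)
  have "\<bar>f b - f a\<bar> = \<bar>(b - a) \<bullet> g (a + \<xi> *\<^sub>R (b - a))\<bar>" using eq by simp
  also have "\<dots> \<le> norm (b - a) * norm (g (a + \<xi> *\<^sub>R (b - a)))" by (rule Cauchy_Schwarz_ineq2)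
  also have "\<dots> \<le> norm (b - a) * L"
    by (intro mult_left_mono bound seg \<xi>) auto
  finally show ?thesis by (simp add: mult.commute)
qed

text \<open>The continuous extension of the gradient differentiates the function even along a half-line
  that runs inside the boundary, as long as translates of an initial piece of it lie in \<open>S\<close> and
  approach it: the mean value theorem holds on the translates, with intermediate points that stay
  close to \<open>z\<close>, and passes to the limit.\<close>

lemma one_sided_derivative:
  fixes f :: "'a::euclidean_space \<Rightarrow> real"
  assumes cont: "continuous_on (closure S) f" and grad: "is_grad_on S f g"
    and e: "e \<longlonglongrightarrow> 0" and h0: "h0 > 0"
    and S: "\<And>m h. 0 < h \<Longrightarrow> h < h0 \<Longrightarrow> z + e m + h *\<^sub>R d \<in> S"
  shows "((\<lambda>h. f (z + h *\<^sub>R d)) has_real_derivative d \<bullet> g z) (at 0 within {0..})"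
proof -
  have clm: "z + e m + h *\<^sub>R d \<in> closure S" if "0 \<le> h" "h < h0" for m h
  proof -
    have "\<forall>\<^sub>F t in at_right h. h < t \<and> t < h0"
      using that eventually_at_right_real[of h h0] by (auto elim: eventually_mono)
    then have "\<forall>\<^sub>F t in at_right h. z + e m + t *\<^sub>R d \<in> closure S"
    proof eventually_elim
      case (elim t)
      then have "z + e m + t *\<^sub>R d \<in> S" using that by (intro S) auto
      then show ?case by (rule subsetD[OF closure_subset])
    qed
    moreover have "((\<lambda>t. z + e m + t *\<^sub>R d) \<longlongrightarrow> z + e m + h *\<^sub>R d) (at_right h)"
      by (intro tendsto_intros)
    ultimately show ?thesis
      by (intro Lim_in_closed_set[OF closed_closure]) auto
  qed
  have lim: "(\<lambda>m. z + e m + h *\<^sub>R d) \<longlonglongrightarrow> z + h *\<^sub>R d" for h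
    using tendsto_add[OF tendsto_add[OF tendsto_const e] tendsto_const] by simp
  have cl: "z + h *\<^sub>R d \<in> closure S" if "0 \<le> h" "h < h0" for h
    using clm[OF that] lim[of h] by (intro Lim_in_closed_set[OF closed_closure _ _ lim]) auto
  have zcl: "z \<in> closure S" using cl[of 0] h0 by simp
  have flim: "(\<lambda>m. f (z + e m + h *\<^sub>R d)) \<longlonglongrightarrow> f (z + h *\<^sub>R d)" if "0 \<le> h" "h < h0" for h
    by (rule continuous_on_tendsto_compose[OF cont lim]) (use that clm cl in auto)
  have "((\<lambda>h. (f (z + h *\<^sub>R d) - f z) / h) \<longlongrightarrow> d \<bullet> g z) (at 0 within {0..})"
  proof (rule tendstoI)
    fix \<epsilon> :: real assume "\<epsilon> > 0"
    have "continuous_on (closure S) (\<lambda>y. d \<bullet> g y)"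
      using grad by (auto simp: is_grad_on_def intro!: continuous_intros)
    then obtain \<delta> where \<delta>: "\<delta> > 0"
      "\<And>y. y \<in> closure S \<Longrightarrow> dist y z < \<delta> \<Longrightarrow> dist (d \<bullet> g y) (d \<bullet> g z) < \<epsilon> / 2"
      using zcl \<open>\<epsilon> > 0\<close> unfolding continuous_on_iff by (metis half_gt_zero)
    define h1 where "h1 = min h0 (\<delta> / (2 * (norm d + 1)))"
    have h1: "h1 > 0" using h0 \<delta> by (simp add: h1_def add_nonneg_pos)
    have est: "\<bar>(f (z + h *\<^sub>R d) - f z) - h * (d \<bullet> g z)\<bar> \<le> h * (\<epsilon> / 2)" if h: "0 < h" "h < h1" for h
    proof -
      have hh0: "h < h0" using h by (simp add: h1_def)
      have "h < \<delta> / (2 * (norm d + 1))" "0 < 2 * (norm d + 1)"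
        using h by (auto simp: h1_def intro: add_nonneg_pos)
      then have "h * (2 * (norm d + 1)) < \<delta>" by (simp only: pos_less_divide_eq)
      then have "h * (norm d + 1) < \<delta> / 2" by (simp add: algebra_simps)
      then have hd: "h * norm d < \<delta> / 2" using h by (simp add: algebra_simps)
      have "\<forall>\<^sub>F m in sequentially. norm (e m) < \<delta> / 2"
        using e \<delta>(1) tendstoD[of e 0 sequentially "\<delta> / 2"] by simp
      then have ev: "\<forall>\<^sub>F m in sequentially.
        \<bar>(f (z + e m + h *\<^sub>R d) - f (z + e m + 0 *\<^sub>R d)) - h * (d \<bullet> g z)\<bar> \<le> h * (\<epsilon> / 2)"
      proof eventually_elim
        case (elim m)
        obtain \<xi> where \<xi>: "0 < \<xi>" "\<xi> < h"
          and eq: "f (z + e m + h *\<^sub>R d) - f (z + e m) = h * (d \<bullet> g (z + e m + \<xi> *\<^sub>R d))"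
          using line_mvt[of h "closure S" f "z + e m" d g] cont clm h hh0 S grad
          by (auto simp: is_grad_on_def)
        have "dist (z + e m + \<xi> *\<^sub>R d) z = norm (e m + \<xi> *\<^sub>R d)"
          by (simp add: dist_norm algebra_simps)
        also have "\<dots> \<le> norm (e m) + \<xi> * norm d"
          using \<xi> norm_triangle_ineq[of "e m" "\<xi> *\<^sub>R d"] by simp
        also have "\<dots> < \<delta>"
          using elim hd mult_right_mono[of \<xi> h "norm d"] \<xi> by simp
        finally have "dist (d \<bullet> g (z + e m + \<xi> *\<^sub>R d)) (d \<bullet> g z) < \<epsilon> / 2"
          using clm \<xi> hh0 by (intro \<delta>(2)) auto
        then have "h * \<bar>d \<bullet> g (z + e m + \<xi> *\<^sub>R d) - d \<bullet> g z\<bar> \<le> h * (\<epsilon> / 2)"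
          using h by (intro mult_left_mono) (auto simp: dist_real_def)
        moreover have "(f (z + e m + h *\<^sub>R d) - f (z + e m + 0 *\<^sub>R d)) - h * (d \<bullet> g z)
            = h * (d \<bullet> g (z + e m + \<xi> *\<^sub>R d) - d \<bullet> g z)"
          using eq by (simp add: algebra_simps)
        ultimately show ?case
          using h by (simp add: abs_mult)
      qed
      have "(\<lambda>m. \<bar>(f (z + e m + h *\<^sub>R d) - f (z + e m + 0 *\<^sub>R d)) - h * (d \<bullet> g z)\<bar>)
          \<longlonglongrightarrow> \<bar>(f (z + h *\<^sub>R d) - f (z + 0 *\<^sub>R d)) - h * (d \<bullet> g z)\<bar>"
        using h hh0 h0 by (intro tendsto_intros flim) auto
      then show ?thesis
        using tendsto_upperbound[OF _ ev] by simp
    qed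
    show "\<forall>\<^sub>F h in at 0 within {0..}. dist ((f (z + h *\<^sub>R d) - f z) / h) (d \<bullet> g z) < \<epsilon>"
      unfolding eventually_at
    proof (intro exI conjI ballI impI)
      show "h1 > 0" by fact
      fix h :: real assume "h \<in> {0..}" "h \<noteq> 0 \<and> dist h 0 < h1"
      then have h: "0 < h" "h < h1" by (auto simp: dist_real_def)
      have "(f (z + h *\<^sub>R d) - f z) / h - d \<bullet> g z = ((f (z + h *\<^sub>R d) - f z) - h * (d \<bullet> g z)) / h"
        using h by (simp add: field_simps)
      then have "\<bar>(f (z + h *\<^sub>R d) - f z) / h - d \<bullet> g z\<bar> \<le> \<epsilon> / 2"
        using est[OF h] h by (simp add: abs_divide pos_divide_le_eq mult.commute)
      then show "dist ((f (z + h *\<^sub>R d) - f z) / h) (d \<bullet> g z) < \<epsilon>"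
        using \<open>\<epsilon> > 0\<close> by (simp add: dist_real_def)
    qed
  qed
  then show ?thesis by (simp add: has_field_derivative_iff)
qed

lemma one_sided_derivative_unique:
  assumes "(f has_real_derivative A) (at 0 within {0..})"
    and "(f has_real_derivative B) (at 0 within {0..})"
  shows "A = B"
proof -
  have "at (0::real) within {0..} \<noteq> bot"
    by (metis at_within_Ici_at_right trivial_limit_at_right_real)
  then show ?thesis
    using assms tendsto_unique unfolding has_field_derivative_iff by blast
qed

lemma is_grad_on_grad_on:
  assumes "C1_closure S f"
  shows "is_grad_on S f (grad_on S f)"
  using assms someI_ex[of "is_grad_on S f"] unfolding C1_closure_def grad_on_def by blast

section \<open>A weighted maximum principle\<close>

text \<open>At a maximum point of \<open>exp (s \<phi>) |z|\<close> with \<open>z \<noteq> 0\<close>, moving in a direction that points into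
  \<open>Q\<close> cannot increase this function, while the weight alone makes it grow at rate \<open>s c\<close>. So the
  derivative of \<open>z\<close> in that direction has to compensate this growth; the last condition in
  \<open>inward\<close>, which is what a transport equation provides, bounds that derivative and hence the maximum. Only the
  direction at the maximum matters, so no trajectory has to be constructed.\<close>

lemma weighted_maximum_principle:
  fixes \<phi> z :: "'a::real_normed_vector \<Rightarrow> real"
  assumes Q: "compact Q" and \<phi>: "continuous_on Q \<phi>" and z: "continuous_on Q z"
    and s: "P < s * c" "s > 0" and B: "B \<ge> 0"
    and inward: "\<And>q. q \<in> Q \<Longrightarrow> z q \<noteq> 0 \<Longrightarrow>
      \<exists>d z'. (\<forall>\<^sub>F h in at_right 0. q + h *\<^sub>R d \<in> Q \<and> \<phi> q + c * h \<le> \<phi> (q + h *\<^sub>R d)) \<and>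
        ((\<lambda>h. z (q + h *\<^sub>R d)) has_real_derivative z') (at 0 within {0..}) \<and>
        exp (s * \<phi> q) * \<bar>z'\<bar> \<le> B + P * (exp (s * \<phi> q) * \<bar>z q\<bar>)"
    and "q \<in> Q"
  shows "exp (s * \<phi> q) * \<bar>z q\<bar> \<le> B / (s * c - P)"
proof -
  define w where "w q = exp (s * \<phi> q) * \<bar>z q\<bar>" for q
  have "continuous_on Q w"
    unfolding w_def using \<phi> z by (intro continuous_intros)
  then obtain m where m: "m \<in> Q" and max: "\<And>q. q \<in> Q \<Longrightarrow> w q \<le> w m"
    using continuous_attains_sup[of Q w] Q \<open>q \<in> Q\<close> by blast
  have "w m \<le> B / (s * c - P)"
  proof (cases "z m = 0")
    case True
    then show ?thesis using B s by (simp add: w_def)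
  next
    case False
    then obtain d z'
      where ev: "\<forall>\<^sub>F h in at_right 0. m + h *\<^sub>R d \<in> Q \<and> \<phi> m + c * h \<le> \<phi> (m + h *\<^sub>R d)"
        and der: "((\<lambda>h. z (m + h *\<^sub>R d)) has_real_derivative z') (at 0 within {0..})"
        and z': "exp (s * \<phi> m) * \<bar>z'\<bar> \<le> B + P * w m"
      using inward[OF m] unfolding w_def by blast
    define \<sigma> where "\<sigma> = sgn (z m)"
    have \<sigma>: "\<bar>\<sigma>\<bar> = 1" "\<sigma> * z m = \<bar>z m\<bar>"
      using False by (auto simp: \<sigma>_def sgn_if)
    define W where "W h = exp (s * (\<phi> m + c * h)) * (\<sigma> * z (m + h *\<^sub>R d))" for h
    have W0: "W 0 = w m" using \<sigma> by (simp add: W_def w_def)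
    have derW: "(W has_real_derivative exp (s * \<phi> m) * (s * c * \<bar>z m\<bar> + \<sigma> * z')) (at 0 within {0..})"
      unfolding W_def using \<sigma>(2) by (auto intro!: derivative_eq_intros der simp: algebra_simps)
    have "exp (s * \<phi> m) * (s * c * \<bar>z m\<bar> + \<sigma> * z') \<le> 0"
    proof (rule ccontr)
      assume "\<not> ?thesis"
      then obtain \<delta> where \<delta>: "\<delta> > 0" "\<And>h. 0 < h \<Longrightarrow> h < \<delta> \<Longrightarrow> W 0 < W h"
        using has_real_derivative_pos_inc_right[OF derW] by auto
      have "\<forall>\<^sub>F h in at_right (0::real). h < \<delta>"
        using \<delta>(1) by (intro order_tendstoD(2)[OF tendsto_ident_at]) auto
      then have "\<forall>\<^sub>F h in at_right (0::real). False"
        using ev eventually_at_right_less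
      proof eventually_elim
        case (elim h)
        have "\<sigma> * z (m + h *\<^sub>R d) \<le> \<bar>z (m + h *\<^sub>R d)\<bar>"
          using abs_ge_self[of "\<sigma> * z (m + h *\<^sub>R d)"] \<sigma>(1) by (simp add: abs_mult)
        then have "W h \<le> exp (s * (\<phi> m + c * h)) * \<bar>z (m + h *\<^sub>R d)\<bar>"
          by (simp add: W_def)
        also have "\<dots> \<le> w (m + h *\<^sub>R d)"
          unfolding w_def using elim s(2) by (intro mult_right_mono) auto
        also have "\<dots> \<le> w m" using elim by (intro max) auto
        finally show False using \<delta>(2)[of h] elim W0 by auto
      qed
      then show False by simp
    qed
    moreover have "- \<sigma> * z' \<le> \<bar>z'\<bar>"
      using abs_ge_self[of "- \<sigma> * z'"] \<sigma>(1) by (simp add: abs_mult)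
    then have "exp (s * \<phi> m) * (- \<sigma> * z') \<le> exp (s * \<phi> m) * \<bar>z'\<bar>"
      by (intro mult_left_mono) auto
    ultimately have "w m * (s * c - P) \<le> B"
      using z' by (simp add: w_def algebra_simps)
    then show ?thesis using s by (simp add: pos_le_divide_eq)
  qed
  then show ?thesis using max[OF \<open>q \<in> Q\<close>] by (simp add: w_def)
qed

section \<open>The equation for the time derivative\<close>

lemma closure_cylinder:
  assumes "T > 0"
  shows "closure (cylinder \<Omega> T) = closure \<Omega> \<times> {0..T}"
  using assms by (simp add: closure_Times)

text \<open>Mixed second derivatives commute although \<open>u\<close> has only one of them by assumption: the mean
  value theorem in time and then in space expresses the second difference by the gradient \<open>K\<close> of
  the time derivative, and the increment in space may then tend to zero for a fixed increment in
  time.\<close>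

lemma time_derivative_of_gradient:
  fixes u v :: "'a::euclidean_space \<times> real \<Rightarrow> real"
  assumes u: "is_grad_on S u G" and v: "is_grad_on S v K" and S: "open S" and xt: "(x, t) \<in> S"
    and uv: "\<And>q. q \<in> S \<Longrightarrow> v q = snd (G q)"
  shows "((\<lambda>s. e \<bullet> fst (G (x, s))) has_real_derivative e \<bullet> fst (K (x, t))) (at t)"
  unfolding DERIV_def
proof (rule tendstoI)
  fix \<epsilon> :: real assume "\<epsilon> > 0"
  define L where "L = e \<bullet> fst (K (x, t))"
  have "continuous_on S (\<lambda>q. e \<bullet> fst (K q))"
    using v closure_subset[of S] continuous_on_subset[of "closure S" K S]
    by (auto simp: is_grad_on_def intro!: continuous_intros)
  then obtain \<delta>1 where \<delta>1: "\<delta>1 > 0"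
    "\<And>q. q \<in> S \<Longrightarrow> dist q (x, t) < \<delta>1 \<Longrightarrow> dist (e \<bullet> fst (K q)) L < \<epsilon> / 2"
    using xt \<open>\<epsilon> > 0\<close> unfolding continuous_on_iff L_def by (metis half_gt_zero)
  obtain \<delta>2 where \<delta>2: "\<delta>2 > 0" "ball (x, t) \<delta>2 \<subseteq> S"
    using S xt open_contains_ball by blast
  define \<delta> where "\<delta> = min \<delta>1 \<delta>2"
  have \<delta>: "\<delta> > 0" using \<delta>1 \<delta>2 by (simp add: \<delta>_def)
  have near: "(x + k *\<^sub>R e, t + h) \<in> S \<and> \<bar>e \<bullet> fst (K (x + k *\<^sub>R e, t + h)) - L\<bar> < \<epsilon> / 2"
    if "\<bar>k\<bar> * norm e < \<delta> / 2" "\<bar>h\<bar> < \<delta> / 2" for k h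
  proof -
    have "dist (x + k *\<^sub>R e, t + h) (x, t) = norm (k *\<^sub>R e, h)"
      by (simp add: dist_norm)
    also have "\<dots> \<le> norm (k *\<^sub>R e) + norm h" by (rule norm_Pair_le)
    also have "\<dots> < \<delta>" using that by simp
    finally have d: "dist (x + k *\<^sub>R e, t + h) (x, t) < \<delta>" .
    then have "(x + k *\<^sub>R e, t + h) \<in> S"
      using \<delta>2(2) by (auto simp: \<delta>_def dist_commute)
    moreover from this have "dist (e \<bullet> fst (K (x + k *\<^sub>R e, t + h))) L < \<epsilon> / 2"
      using d by (intro \<delta>1(2)) (auto simp: \<delta>_def)
    ultimately show ?thesis by (simp add: dist_real_def)
  qed
  have second_difference:
    "\<bar>(u (x + k *\<^sub>R e, t + h) - u (x, t + h)) - (u (x + k *\<^sub>R e, t) - u (x, t)) - k * h * L\<bar>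
      \<le> k * \<bar>h\<bar> * (\<epsilon> / 2)"
    if k: "0 < k" "k * norm e < \<delta> / 2" and h: "\<bar>h\<bar> < \<delta> / 2" for k h
  proof -
    have small: "\<bar>a * k\<bar> * norm e < \<delta> / 2" "\<bar>b * h\<bar> < \<delta> / 2"
      if "0 \<le> a" "a \<le> 1" "0 \<le> b" "b \<le> 1" for a b
    proof -
      have "a * (k * norm e) \<le> 1 * (k * norm e)" using that k by (intro mult_right_mono) auto
      also have "\<dots> < \<delta> / 2" using k by simp
      finally show "\<bar>a * k\<bar> * norm e < \<delta> / 2" using k that by (simp add: abs_mult mult.assoc)
      have "b * \<bar>h\<bar> \<le> 1 * \<bar>h\<bar>" using that by (intro mult_right_mono) auto
      then show "\<bar>b * h\<bar> < \<delta> / 2" using h that by (simp add: abs_mult)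
    qed
    define r where "r s = u (x + k *\<^sub>R e, t + s * h) - u (x, t + s * h)" for s
    have line: "((\<lambda>s. u (y, t + s * h)) has_real_derivative h * v (y, t + s * h)) (at s)"
      if "(y, t + s * h) \<in> S" for y s
    proof -
      have "GDERIV u ((y, t) + s *\<^sub>R (0, h)) :> G (y, t + s * h)"
        using u that by (simp add: is_grad_on_def)
      from gderiv_along_line[OF this] show ?thesis
        using uv[OF that] by (simp add: inner_prod_def)
    qed
    have "(r has_real_derivative h * v (x + k *\<^sub>R e, t + s * h) - h * v (x, t + s * h)) (at s)"
      if "0 \<le> s" "s \<le> 1" for s
    proof -
      have "(x + k *\<^sub>R e, t + s * h) \<in> S" "(x, t + s * h) \<in> S"
        using near[of k "s * h"] near[of 0 "s * h"] small[of 1 s] small[of 0 s] that k by auto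
      then show ?thesis unfolding r_def by (intro DERIV_diff line)
    qed
    then obtain s where s: "0 < s" "s < 1"
      and r: "r 1 - r 0 = (1 - 0) * (h * v (x + k *\<^sub>R e, t + s * h) - h * v (x, t + s * h))"
      using MVT2[of 0 1 r "\<lambda>s. h * v (x + k *\<^sub>R e, t + s * h) - h * v (x, t + s * h)"] by auto
    have seg: "(x, t + s * h) + a *\<^sub>R (k *\<^sub>R e, 0) \<in> S" if "0 \<le> a" "a \<le> 1" for a
      using near[of "a * k" "s * h"] small[of a s] that s by auto
    have "continuous_on S v"
    proof (rule continuous_at_imp_continuous_on, rule ballI)
      fix q assume "q \<in> S"
      then show "isCont v q"
        using v has_derivative_continuous unfolding is_grad_on_def gderiv_def by blast
    qed
    then obtain a where a: "0 < a" "a < 1"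
      and v': "v ((x, t + s * h) + 1 *\<^sub>R (k *\<^sub>R e, 0)) - v (x, t + s * h)
        = 1 * ((k *\<^sub>R e, 0) \<bullet> K ((x, t + s * h) + a *\<^sub>R (k *\<^sub>R e, 0)))"
      using line_mvt[of 1 S v "(x, t + s * h)" "(k *\<^sub>R e, 0)" K] seg v
      by (auto simp: is_grad_on_def)
    define q where "q = (x + (a * k) *\<^sub>R e, t + s * h)"
    have "v (x + k *\<^sub>R e, t + s * h) - v (x, t + s * h) = k * (e \<bullet> fst (K q))"
      using v' by (simp add: inner_prod_def q_def)
    then have "r 1 - r 0 - k * h * L = k * h * (e \<bullet> fst (K q) - L)"
      using r by (simp add: right_diff_distrib[symmetric]) (simp add: algebra_simps)
    then have "\<bar>r 1 - r 0 - k * h * L\<bar> = k * \<bar>h\<bar> * \<bar>e \<bullet> fst (K q) - L\<bar>"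
      using k by (simp add: abs_mult)
    also have "\<dots> \<le> k * \<bar>h\<bar> * (\<epsilon> / 2)"
      using near[of "a * k" "s * h"] small[of a s] a s k
      by (intro mult_left_mono) (auto simp: q_def)
    finally show ?thesis by (simp add: r_def)
  qed
  have quotient: "((\<lambda>k. (u (x + k *\<^sub>R e, s) - u (x, s)) / k) \<longlongrightarrow> e \<bullet> fst (G (x, s))) (at_right 0)"
    if "(x, s) \<in> S" for s
  proof -
    have "GDERIV u (x, s) :> G (x, s)" using u that by (simp add: is_grad_on_def)
    from gderiv_line[OF this, of "(e, 0)"]
    have "((\<lambda>k. (u (x + k *\<^sub>R e, s) - u (x, s)) / k) \<longlongrightarrow> e \<bullet> fst (G (x, s))) (at 0)"
      by (simp add: DERIV_def inner_prod_def)
    then show ?thesis by (rule filterlim_mono) (auto simp: at_le)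
  qed
  show "\<forall>\<^sub>F h in at 0. dist ((e \<bullet> fst (G (x, t + h)) - e \<bullet> fst (G (x, t))) / h) (e \<bullet> fst (K (x, t))) < \<epsilon>"
    unfolding eventually_at
  proof (intro exI conjI ballI impI)
    show "\<delta> / 2 > 0" using \<delta> by simp
    fix h :: real assume "h \<noteq> 0 \<and> dist h 0 < \<delta> / 2"
    then have h: "h \<noteq> 0" "\<bar>h\<bar> < \<delta> / 2" by auto
    have "\<forall>\<^sub>F k in at_right 0. k < \<delta> / (2 * (norm e + 1))"
      using \<delta> by (intro order_tendstoD(2)[OF tendsto_ident_at]) (simp add: add_nonneg_pos)
    then have ev: "\<forall>\<^sub>F k in at_right 0.
      \<bar>(u (x + k *\<^sub>R e, t + h) - u (x, t + h)) / k - (u (x + k *\<^sub>R e, t) - u (x, t)) / k - h * L\<bar>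
        \<le> \<bar>h\<bar> * (\<epsilon> / 2)"
      using eventually_at_right_less
    proof eventually_elim
      case (elim k)
      have "0 < 2 * (norm e + 1)" by (simp add: add_nonneg_pos)
      then have "k * (2 * (norm e + 1)) < \<delta>"
        using elim by (simp only: pos_less_divide_eq)
      then have "k * norm e < \<delta> / 2" using elim by (simp add: algebra_simps)
      from second_difference[OF _ this h(2)] elim
      have "\<bar>(u (x + k *\<^sub>R e, t + h) - u (x, t + h)) - (u (x + k *\<^sub>R e, t) - u (x, t)) - k * h * L\<bar> / k
          \<le> k * \<bar>h\<bar> * (\<epsilon> / 2) / k"
        by (intro divide_right_mono) auto
      moreover have "\<bar>(u (x + k *\<^sub>R e, t + h) - u (x, t + h)) - (u (x + k *\<^sub>R e, t) - u (x, t)) - k * h * L\<bar> / k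
         = \<bar>((u (x + k *\<^sub>R e, t + h) - u (x, t + h)) - (u (x + k *\<^sub>R e, t) - u (x, t)) - k * h * L) / k\<bar>"
        using elim by (simp add: abs_divide)
      ultimately show ?case using elim by (simp add: diff_divide_distrib)
    qed
    have "(x, t + h) \<in> S" using near[of 0 h] h \<delta> by simp
    then have "((\<lambda>k. \<bar>(u (x + k *\<^sub>R e, t + h) - u (x, t + h)) / k
          - (u (x + k *\<^sub>R e, t) - u (x, t)) / k - h * L\<bar>)
        \<longlongrightarrow> \<bar>e \<bullet> fst (G (x, t + h)) - e \<bullet> fst (G (x, t)) - h * L\<bar>) (at_right 0)"
      using xt by (intro tendsto_intros quotient)
    from tendsto_upperbound[OF this ev]
    have est: "\<bar>e \<bullet> fst (G (x, t + h)) - e \<bullet> fst (G (x, t)) - h * L\<bar> \<le> \<bar>h\<bar> * (\<epsilon> / 2)" by simp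
    have "(e \<bullet> fst (G (x, t + h)) - e \<bullet> fst (G (x, t))) / h - L
        = (e \<bullet> fst (G (x, t + h)) - e \<bullet> fst (G (x, t)) - h * L) / h"
      using h by (simp add: field_simps)
    then have "\<bar>(e \<bullet> fst (G (x, t + h)) - e \<bullet> fst (G (x, t))) / h - L\<bar> \<le> \<epsilon> / 2"
      using est h by (simp add: abs_divide pos_divide_le_eq mult.commute)
    then show "dist ((e \<bullet> fst (G (x, t + h)) - e \<bullet> fst (G (x, t))) / h) (e \<bullet> fst (K (x, t))) < \<epsilon>"
      using \<open>\<epsilon> > 0\<close> by (simp add: dist_real_def L_def)
  qed
qed

lemma continuous_zero_extends:
  fixes f :: "real \<Rightarrow> real"
  assumes "T > 0" and "continuous_on {0..T} f" and "\<And>t. 0 < t \<Longrightarrow> t < T \<Longrightarrow> f t = 0"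
    and "0 \<le> t" "t \<le> T"
  shows "f t = 0"
  using assms continuous_constant_on_closure[of "{0<..<T}" f 0 t] by auto

lemma continuous_on_time_slice:
  assumes "continuous_on (closure (cylinder \<Omega> T)) f" and "T > 0" and "x \<in> closure \<Omega>"
  shows "continuous_on {0..T} (\<lambda>t. f (x, t))"
proof (rule continuous_on_compose2[OF assms(1)])
  show "continuous_on {0..T} (Pair x)" by (intro continuous_intros)
  show "Pair x ` {0..T} \<subseteq> closure (cylinder \<Omega> T)"
    using assms by (auto simp: closure_cylinder)
qed

context
  fixes \<Omega> :: "(real^'n) set" and T :: real and p a u and H :: "real^'n \<Rightarrow> real^'n" and x
  assumes sol: "is_solution \<Omega> T p H a u" and \<Omega>: "open \<Omega>" and T: "T > 0" and x: "x \<in> \<Omega>"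
begin

lemma solution_grad: "is_grad_on (cylinder \<Omega> T) u (grad_on (cylinder \<Omega> T) u)"
  using sol is_grad_on_grad_on unfolding is_solution_def by blast

lemma solution_equation_closed:
  assumes "0 \<le> t" "t \<le> T"
  shows "dt \<Omega> T u (x, t) + H x \<bullet> grad_x \<Omega> T u (x, t) + p x * u (x, t) = 0"
proof (rule continuous_zero_extends[OF T _ _ assms])
  have xc: "x \<in> closure \<Omega>" using x closure_subset by blast
  have "continuous_on {0..T} (\<lambda>t. grad_on (cylinder \<Omega> T) u (x, t))"
    using solution_grad xc T by (intro continuous_on_time_slice) (auto simp: is_grad_on_def)
  moreover have "continuous_on {0..T} (\<lambda>t. u (x, t))"
    using sol xc T by (intro continuous_on_time_slice) (auto simp: is_solution_def C1_closure_def)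
  ultimately show "continuous_on {0..T}
      (\<lambda>t. dt \<Omega> T u (x, t) + H x \<bullet> grad_x \<Omega> T u (x, t) + p x * u (x, t))"
    unfolding dt_def grad_x_def by (intro continuous_intros)
  show "dt \<Omega> T u (x, t) + H x \<bullet> grad_x \<Omega> T u (x, t) + p x * u (x, t) = 0" if "0 < t" "t < T" for t
    using sol x that by (simp add: is_solution_def)
qed

text \<open>The coefficients do not depend on time, so the time derivative solves the same equation.\<close>

lemma dt_equation_closed:
  assumes C1: "C1_closure (cylinder \<Omega> T) (dt \<Omega> T u)" and t: "0 \<le> t" "t \<le> T"
  defines "K \<equiv> grad_on (cylinder \<Omega> T) (dt \<Omega> T u)"
  shows "snd (K (x, t)) + H x \<bullet> fst (K (x, t)) + p x * dt \<Omega> T u (x, t) = 0"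
proof (rule continuous_zero_extends[OF T _ _ t])
  have xc: "x \<in> closure \<Omega>" using x closure_subset by blast
  have K: "is_grad_on (cylinder \<Omega> T) (dt \<Omega> T u) K"
    unfolding K_def by (rule is_grad_on_grad_on[OF C1])
  have "continuous_on {0..T} (\<lambda>t. K (x, t))"
    using K xc T by (intro continuous_on_time_slice) (auto simp: is_grad_on_def)
  moreover have "continuous_on {0..T} (\<lambda>t. dt \<Omega> T u (x, t))"
    using C1 xc T by (intro continuous_on_time_slice) (auto simp: C1_closure_def)
  ultimately show "continuous_on {0..T}
      (\<lambda>t. snd (K (x, t)) + H x \<bullet> fst (K (x, t)) + p x * dt \<Omega> T u (x, t))"
    by (intro continuous_intros)
  fix t assume t: "0 < t" "t < T"
  let ?E = "\<lambda>s. dt \<Omega> T u (x, s) + H x \<bullet> grad_x \<Omega> T u (x, s) + p x * u (x, s)"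
  have xt: "(x, t) \<in> cylinder \<Omega> T" using x t by simp
  have cyl: "open (cylinder \<Omega> T)" using \<Omega> by (intro open_Times) auto
  have 1: "((\<lambda>s. dt \<Omega> T u (x, s)) has_real_derivative snd (K (x, t))) (at t)"
  proof -
    have "GDERIV (dt \<Omega> T u) ((x, 0) + t *\<^sub>R (0, 1)) :> K (x, t)"
      using K xt by (simp add: is_grad_on_def)
    from gderiv_along_line[OF this] show ?thesis by (simp add: inner_prod_def)
  qed
  have 2: "((\<lambda>s. u (x, s)) has_real_derivative dt \<Omega> T u (x, t)) (at t)"
  proof -
    have "GDERIV u ((x, 0) + t *\<^sub>R (0, 1)) :> grad_on (cylinder \<Omega> T) u (x, t)"
      using solution_grad xt by (simp add: is_grad_on_def)
    from gderiv_along_line[OF this] show ?thesis by (simp add: inner_prod_def dt_def)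
  qed
  have 3: "((\<lambda>s. H x \<bullet> grad_x \<Omega> T u (x, s)) has_real_derivative H x \<bullet> fst (K (x, t))) (at t)"
    unfolding grad_x_def
    by (rule time_derivative_of_gradient[OF solution_grad K cyl xt]) (simp add: dt_def)
  have "(?E has_real_derivative snd (K (x, t)) + H x \<bullet> fst (K (x, t)) + p x * dt \<Omega> T u (x, t)) (at t)"
    by (intro DERIV_add DERIV_cmult 1 2 3)
  moreover have "(?E has_real_derivative 0) (at t)"
  proof (rule has_field_derivative_transform_within_open[OF DERIV_const, where S = "{0<..<T}"])
    show "0 = ?E s" if "s \<in> {0<..<T}" for s
      using sol x that by (simp add: is_solution_def)
  qed (use t in auto)
  ultimately show "snd (K (x, t)) + H x \<bullet> fst (K (x, t)) + p x * dt \<Omega> T u (x, t) = 0"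
    by (rule DERIV_unique)
qed

text \<open>The initial condition concerns values on the bottom of the cylinder, where \<open>grad_x\<close> is a limit
  from inside; translating segments in \<open>\<Omega>\<close> forward in time connects the two.\<close>

lemma initial_gradient:
  assumes a: "C1_closure \<Omega> a"
  shows "grad_x \<Omega> T u (x, 0) = grad_on \<Omega> a x"
proof -
  have "w \<bullet> grad_x \<Omega> T u (x, 0) = w \<bullet> grad_on \<Omega> a x" for w
  proof -
    have "((\<lambda>h. x + h *\<^sub>R w) \<longlongrightarrow> x + 0 *\<^sub>R w) (at 0)" by (intro tendsto_intros)
    then have "\<forall>\<^sub>F h in at 0. x + h *\<^sub>R w \<in> \<Omega>"
      using \<Omega> x by (intro topological_tendstoD) auto
    then obtain h0 where h0: "h0 > 0" "\<And>h. h \<noteq> 0 \<Longrightarrow> \<bar>h\<bar> < h0 \<Longrightarrow> x + h *\<^sub>R w \<in> \<Omega>"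
      unfolding eventually_at by auto
    then have mem: "x + h *\<^sub>R w \<in> \<Omega>" if "\<bar>h\<bar> < h0" for h
      using x that by (cases "h = 0") auto
    define e :: "nat \<Rightarrow> (real^'n) \<times> real" where "e m = (0, T / real (m + 2))" for m
    have "(\<lambda>m. T / real (m + 2)) \<longlonglongrightarrow> 0"
      by (rule LIMSEQ_ignore_initial_segment[OF lim_const_over_n])
    then have "(\<lambda>m. (0::real^'n, T / real (m + 2))) \<longlonglongrightarrow> (0, 0)"
      by (intro tendsto_intros)
    then have e: "e \<longlonglongrightarrow> 0" unfolding e_def zero_prod_def .
    have "((\<lambda>h. u ((x, 0) + h *\<^sub>R (w, 0))) has_real_derivative
        (w, 0) \<bullet> grad_on (cylinder \<Omega> T) u (x, 0)) (at 0 within {0..})"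
    proof (rule one_sided_derivative[OF _ solution_grad e h0(1)])
      show "continuous_on (closure (cylinder \<Omega> T)) u"
        using sol by (simp add: is_solution_def C1_closure_def)
      show "(x, 0) + e m + h *\<^sub>R (w, 0) \<in> cylinder \<Omega> T" if "0 < h" "h < h0" for m h
        using that mem T by (auto simp: e_def divide_less_eq)
    qed
    then have "((\<lambda>h. u (x + h *\<^sub>R w, 0)) has_real_derivative w \<bullet> grad_x \<Omega> T u (x, 0)) (at 0 within {0..})"
      by (simp add: inner_prod_def grad_x_def)
    then have "((\<lambda>h. a (x + h *\<^sub>R w)) has_real_derivative w \<bullet> grad_x \<Omega> T u (x, 0)) (at 0 within {0..})"
    proof (rule has_field_derivative_transform_within[OF _ h0(1)])
      show "u (x + h *\<^sub>R w, 0) = a (x + h *\<^sub>R w)" if "dist h 0 < h0" for h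
        using sol mem that by (simp add: is_solution_def)
    qed auto
    moreover have "GDERIV a x :> grad_on \<Omega> a x"
      using is_grad_on_grad_on[OF a] x by (simp add: is_grad_on_def)
    from gderiv_line[OF this]
    have "((\<lambda>h. a (x + h *\<^sub>R w)) has_real_derivative w \<bullet> grad_on \<Omega> a x) (at 0 within {0..})"
      by (rule has_field_derivative_at_within)
    ultimately show ?thesis by (rule one_sided_derivative_unique)
  qed
  then show ?thesis using vector_eq_ldot by blast
qed

lemma initial_dt:
  assumes "C1_closure \<Omega> a"
  shows "dt \<Omega> T u (x, 0) = - (H x \<bullet> grad_on \<Omega> a x) - p x * a x"
  using solution_equation_closed[of 0] initial_gradient[OF assms] T sol x
  by (simp add: is_solution_def)

end

text \<open>At a point of the lateral boundary the time derivative is again a limit from inside: the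
  line in the time direction is approached by parallel lines through points of \<open>\<Omega>\<close>.\<close>

lemma dt_eq_on_boundary:
  assumes u1: "C1_closure (cylinder \<Omega> T) u1" and u2: "C1_closure (cylinder \<Omega> T) u2"
    and T: "T > 0" and x: "x \<in> closure \<Omega>"
    and eq: "\<And>t. 0 < t \<Longrightarrow> t < T \<Longrightarrow> u1 (x, t) = u2 (x, t)" and t: "0 \<le> t" "t \<le> T"
  shows "dt \<Omega> T u1 (x, t) = dt \<Omega> T u2 (x, t)"
proof -
  have cont: "continuous_on {0..T} (\<lambda>t. dt \<Omega> T u (x, t))" if "C1_closure (cylinder \<Omega> T) u" for u
  proof -
    have "continuous_on {0..T} (\<lambda>t. grad_on (cylinder \<Omega> T) u (x, t))"
      using is_grad_on_grad_on[OF that] x T by (intro continuous_on_time_slice) (auto simp: is_grad_on_def)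
    then show ?thesis unfolding dt_def by (intro continuous_intros)
  qed
  obtain X where X: "\<And>m. X m \<in> \<Omega>" "X \<longlonglongrightarrow> x"
    using x closure_sequential by blast
  have "(\<lambda>m. X m - x) \<longlonglongrightarrow> 0" using X(2) by (simp add: LIM_zero)
  then have "(\<lambda>m. (X m - x, 0::real)) \<longlonglongrightarrow> (0, 0)" by (intro tendsto_intros)
  then have e: "(\<lambda>m. (X m - x, 0::real)) \<longlonglongrightarrow> 0" by (simp add: zero_prod_def)
  have "dt \<Omega> T u1 (x, t) - dt \<Omega> T u2 (x, t) = 0"
  proof (rule continuous_zero_extends[OF T _ _ t])
    show "continuous_on {0..T} (\<lambda>t. dt \<Omega> T u1 (x, t) - dt \<Omega> T u2 (x, t))"
      by (intro continuous_intros cont u1 u2)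
    fix t assume t: "0 < t" "t < T"
    have der: "((\<lambda>h. u (x, t + h)) has_real_derivative dt \<Omega> T u (x, t)) (at 0 within {0..})"
      if u: "C1_closure (cylinder \<Omega> T) u" for u
    proof -
      have "((\<lambda>h. u ((x, t) + h *\<^sub>R (0, 1))) has_real_derivative
        (0, 1) \<bullet> grad_on (cylinder \<Omega> T) u (x, t)) (at 0 within {0..})"
      proof (rule one_sided_derivative[OF _ is_grad_on_grad_on[OF u] e])
        show "continuous_on (closure (cylinder \<Omega> T)) u" using u by (simp add: C1_closure_def)
        show "T - t > 0" using t by simp
        show "(x, t) + (X m - x, 0) + h *\<^sub>R (0, 1) \<in> cylinder \<Omega> T" if "0 < h" "h < T - t" for m h
          using that X(1) t by auto
      qed
      then show ?thesis by (simp add: inner_prod_def dt_def)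
    qed
    have "((\<lambda>h. u2 (x, t + h)) has_real_derivative dt \<Omega> T u1 (x, t)) (at 0 within {0..})"
    proof (rule has_field_derivative_transform_within[OF der[OF u1], of "T - t"])
      show "u1 (x, t + h) = u2 (x, t + h)" if "h \<in> {0..}" "dist h 0 < T - t" for h
        using that t by (intro eq) auto
    qed (use t in auto)
    then show "dt \<Omega> T u1 (x, t) - dt \<Omega> T u2 (x, t) = 0"
      using one_sided_derivative_unique[OF _ der[OF u2]] by simp
  qed
  then show ?thesis by simp
qed

section \<open>The domain near a boundary point\<close>

text \<open>Near \<open>x0\<close>, moves along directions in a cone around the inner normal strictly decrease a
  defining function, so they lead into the domain even from a boundary point.\<close>

lemma inward_cone:
  assumes \<Omega>: "bounded_smooth_domain \<Omega>" and x0: "x0 \<in> frontier \<Omega>" and \<eta>: "\<eta> > 0"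
  defines "\<nu> \<equiv> outward_normal \<Omega> x0"
  shows "norm \<nu> = 1"
    and "\<exists>r>0. \<forall>x\<in>closure \<Omega> \<inter> ball x0 r. \<forall>y\<in>ball x0 r.
      y \<noteq> x \<and> (y - x) \<bullet> \<nu> \<le> - \<eta> * norm (y - x) \<longrightarrow> y \<in> \<Omega>"
proof -
  have op: "open \<Omega>" using \<Omega> by (simp add: bounded_smooth_domain_def)
  obtain U \<rho> where l: "local_defining_function \<Omega> x0 U \<rho>"
    using \<Omega> x0 unfolding bounded_smooth_domain_def smooth_boundary_def by blast
  then have U: "open U" "x0 \<in> U" and \<rho>U: "\<And>y. y \<in> U \<Longrightarrow> y \<in> \<Omega> \<longleftrightarrow> \<rho> y < 0"
    and crit: "\<And>y. y \<in> U \<Longrightarrow> \<not> (GDERIV \<rho> y :> 0)" and smooth: "Ck_on (Suc 0) U \<rho>"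
    unfolding local_defining_function_def smooth_on_def by blast+
  from smooth obtain g where g: "\<And>y. y \<in> U \<Longrightarrow> GDERIV \<rho> y :> g y"
    and gb: "\<And>b. b \<in> Basis \<Longrightarrow> continuous_on U (\<lambda>y. g y \<bullet> b)"
    by auto
  have gc: "continuous_on U g" using gb by (subst continuous_on_componentwise) blast
  have g0: "g x0 \<noteq> 0" using g[OF U(2)] crit[OF U(2)] by metis
  have \<nu>: "\<nu> = g x0 /\<^sub>R norm (g x0)"
    unfolding \<nu>_def using outward_normal_eq[OF l op x0 g[OF U(2)]] .
  show "norm \<nu> = 1" using g0 by (simp add: \<nu>)
  have g\<nu>: "g x0 = norm (g x0) *\<^sub>R \<nu>" using g0 by (simp add: \<nu>)
  have \<rho>c: "continuous_on U \<rho>"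
  proof (rule continuous_at_imp_continuous_on, rule ballI)
    fix y assume "y \<in> U"
    then show "isCont \<rho> y"
      using g has_derivative_continuous unfolding gderiv_def by blast
  qed
  have closure: "\<rho> x \<le> 0" if x: "x \<in> closure \<Omega>" "x \<in> U" for x
  proof (rule ccontr)
    assume "\<not> \<rho> x \<le> 0"
    have "open (U \<inter> \<rho> -` {0<..})"
      by (rule continuous_open_preimage[OF \<rho>c U(1)]) auto
    moreover have "x \<in> U \<inter> \<rho> -` {0<..}" using x \<open>\<not> \<rho> x \<le> 0\<close> by auto
    moreover have "\<Omega> \<inter> (U \<inter> \<rho> -` {0<..}) = {}" using \<rho>U by force
    ultimately show False using x(1) by (auto simp: closure_iff_nhds_not_empty)
  qed
  obtain r1 where r1: "r1 > 0" "ball x0 r1 \<subseteq> U" using U open_contains_ball by blast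
  have "\<eta> / 2 * norm (g x0) > 0" using \<eta> g0 by simp
  then obtain r2 where r2: "r2 > 0"
    "\<And>y. y \<in> U \<Longrightarrow> dist y x0 < r2 \<Longrightarrow> dist (g y) (g x0) < \<eta> / 2 * norm (g x0)"
    using gc U(2) unfolding continuous_on_iff by metis
  define r where "r = min r1 r2"
  have r: "r > 0" "ball x0 r \<subseteq> U" using r1 r2 by (auto simp: r_def)
  have "y \<in> \<Omega>" if x: "x \<in> closure \<Omega>" "x \<in> ball x0 r" and y: "y \<in> ball x0 r" "y \<noteq> x"
    and cone: "(y - x) \<bullet> \<nu> \<le> - \<eta> * norm (y - x)" for x y
  proof -
    have seg: "x + t *\<^sub>R (y - x) \<in> ball x0 r" if "0 \<le> t" "t \<le> 1" for t
    proof -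
      have "x + t *\<^sub>R (y - x) = (1 - t) *\<^sub>R x + t *\<^sub>R y" by (simp add: algebra_simps)
      then show ?thesis using convexD[OF convex_ball x(2) y(1), of "1 - t" t] that by simp
    qed
    obtain \<xi> where \<xi>: "0 < \<xi>" "\<xi> < 1"
      and mv: "\<rho> (x + 1 *\<^sub>R (y - x)) - \<rho> x = 1 * ((y - x) \<bullet> g (x + \<xi> *\<^sub>R (y - x)))"
      using line_mvt[of 1 U \<rho> x "y - x" g] \<rho>c seg r(2) g by (meson less_eq_real_def subsetD zero_less_one)
    define q where "q = x + \<xi> *\<^sub>R (y - x)"
    have q: "q \<in> ball x0 r" unfolding q_def using \<xi> by (intro seg) auto
    then have "norm (g q - g x0) < \<eta> / 2 * norm (g x0)"
      using r2(2)[of q] subsetD[OF r(2) q] by (simp add: r_def dist_norm norm_minus_commute)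
    then have "norm (y - x) * norm (g q - g x0) \<le> norm (y - x) * (\<eta> / 2 * norm (g x0))"
      by (intro mult_left_mono) auto
    with norm_cauchy_schwarz[of "y - x" "g q - g x0"]
    have "(y - x) \<bullet> (g q - g x0) \<le> norm (y - x) * (\<eta> / 2 * norm (g x0))" by linarith
    moreover have "(y - x) \<bullet> g x0 \<le> norm (g x0) * (- \<eta> * norm (y - x))"
      using mult_left_mono[OF cone norm_ge_zero[of "g x0"]] by (subst g\<nu>) simp
    moreover have "\<eta> * (norm (g x0) * norm (y - x)) > 0" using \<eta> g0 y(2) by simp
    ultimately have "(y - x) \<bullet> g q < 0"
      by (simp add: inner_diff_right algebra_simps)
    moreover have "\<rho> x \<le> 0" using closure x r(2) by blast
    ultimately have "\<rho> y < 0" using mv by (simp add: q_def)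
    then show "y \<in> \<Omega>" using \<rho>U y(1) r(2) by blast
  qed
  then show "\<exists>r>0. \<forall>x\<in>closure \<Omega> \<inter> ball x0 r. \<forall>y\<in>ball x0 r.
      y \<noteq> x \<and> (y - x) \<bullet> \<nu> \<le> - \<eta> * norm (y - x) \<longrightarrow> y \<in> \<Omega>"
    using r(1) by blast
qed

lemma admissible_continuous:
  assumes "H \<in> admissible \<Omega> x0 M \<delta>0"
  shows "continuous_on (closure \<Omega>) H"
proof -
  have "continuous_on (closure \<Omega>) (\<lambda>x. \<chi> j. H x $ j)"
    using assms by (intro continuous_on_vec_lambda) (auto simp: admissible_def C1_closure_def)
  then show ?thesis by simp
qed

lemma
  fixes H :: "real^'n \<Rightarrow> real^'n"
  assumes H: "H \<in> admissible \<Omega> x0 M \<delta>0" and \<Omega>: "bounded \<Omega>" and x: "x \<in> closure \<Omega>"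
  shows admissible_norm_le: "norm (H x) \<le> M"
    and admissible_grad_le: "sqrt (\<Sum>j\<in>UNIV. (norm (grad_on \<Omega> (\<lambda>y. H y $ j) x))\<^sup>2) \<le> M"
proof -
  let ?J = "\<lambda>x. sqrt (\<Sum>j\<in>UNIV. \<Sum>k\<in>UNIV. \<bar>grad_on \<Omega> (\<lambda>y. H y $ j) x $ k\<bar>\<^sup>2)"
  have comp: "compact (closure \<Omega>)" using \<Omega> by simp
  have "continuous_on (closure \<Omega>) (grad_on \<Omega> (\<lambda>y. H y $ j))" for j
    using H is_grad_on_grad_on unfolding admissible_def is_grad_on_def by blast
  then have "continuous_on (closure \<Omega>) ?J"
    by (intro continuous_intros)
  then have J: "?J x \<le> (SUP x\<in>closure \<Omega>. ?J x)"
    using x comp by (intro cSUP_upper bounded_imp_bdd_above compact_imp_bounded compact_continuous_image)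
  have "continuous_on (closure \<Omega>) (\<lambda>x. norm (H x))"
    using admissible_continuous[OF H] by (intro continuous_intros)
  then have N: "norm (H x) \<le> (SUP x\<in>closure \<Omega>. norm (H x))"
    using x comp by (intro cSUP_upper bounded_imp_bdd_above compact_imp_bounded compact_continuous_image)
  have M: "(SUP x\<in>closure \<Omega>. norm (H x)) + (SUP x\<in>closure \<Omega>. ?J x) \<le> M"
    using H by (simp add: admissible_def C1_norm_def)
  have "0 \<le> ?J x" by (intro real_sqrt_ge_zero sum_nonneg) auto
  then show "norm (H x) \<le> M" using J N M by linarith
  have "?J x \<le> M" using J N M norm_ge_zero[of "H x"] by linarith
  then show "sqrt (\<Sum>j\<in>UNIV. (norm (grad_on \<Omega> (\<lambda>y. H y $ j) x))\<^sup>2) \<le> M"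
    by (simp add: norm_vec_def L2_set_def sum_nonneg)
qed

lemma admissible_component_lipschitz:
  fixes H :: "real^'n \<Rightarrow> real^'n"
  assumes H: "H \<in> admissible \<Omega> x0 M \<delta>0" and \<Omega>: "bounded \<Omega>" and w: "norm w = 1"
    and ab: "a \<in> closure \<Omega>" "b \<in> closure \<Omega>"
    and seg: "\<And>t. 0 < t \<Longrightarrow> t < 1 \<Longrightarrow> a + t *\<^sub>R (b - a) \<in> \<Omega>"
  shows "\<bar>H b \<bullet> w - H a \<bullet> w\<bar> \<le> M * norm (b - a)"
proof (rule gradient_bound_imp_lipschitz[OF _ _ _ ab seg])
  let ?D = "\<lambda>j. grad_on \<Omega> (\<lambda>y. H y $ j)"
  have grad: "is_grad_on \<Omega> (\<lambda>y. H y $ j) (?D j)" for j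
    using H is_grad_on_grad_on unfolding admissible_def by blast
  show "continuous_on (closure \<Omega>) (\<lambda>y. H y \<bullet> w)"
    using admissible_continuous[OF H] by (intro continuous_intros)
  show "is_grad_on \<Omega> (\<lambda>y. H y \<bullet> w) (\<lambda>y. \<Sum>j\<in>UNIV. (w $ j) *\<^sub>R ?D j y)"
    unfolding is_grad_on_def
  proof (intro conjI ballI)
    show "continuous_on (closure \<Omega>) (\<lambda>y. \<Sum>j\<in>UNIV. (w $ j) *\<^sub>R ?D j y)"
      using grad by (intro continuous_intros) (auto simp: is_grad_on_def)
    fix y assume "y \<in> \<Omega>"
    then have "((\<lambda>y. H y $ j) has_derivative (\<lambda>h. h \<bullet> ?D j y)) (at y)" for j
      using grad by (simp add: is_grad_on_def gderiv_def)
    then have "((\<lambda>y. \<Sum>j\<in>UNIV. H y $ j * w $ j) has_derivative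
        (\<lambda>h. \<Sum>j\<in>UNIV. (h \<bullet> ?D j y) * w $ j)) (at y)"
      by (intro has_derivative_sum has_derivative_mult_left)
    then show "GDERIV (\<lambda>y. H y \<bullet> w) y :> (\<Sum>j\<in>UNIV. (w $ j) *\<^sub>R ?D j y)"
      by (simp add: gderiv_def inner_vec_def[of "H _"] inner_sum_right mult.commute)
  qed
  fix y assume y: "y \<in> \<Omega>"
  have "norm (\<Sum>j\<in>UNIV. (w $ j) *\<^sub>R ?D j y) \<le> (\<Sum>j\<in>UNIV. \<bar>w $ j\<bar> * \<bar>norm (?D j y)\<bar>)"
    by (rule norm_sum[THEN order_trans]) simp
  also have "\<dots> \<le> L2_set (\<lambda>j. w $ j) UNIV * L2_set (\<lambda>j. norm (?D j y)) UNIV"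
    by (rule L2_set_mult_ineq)
  also have "L2_set (\<lambda>j. w $ j) UNIV = 1" using w by (simp add: norm_vec_def L2_set_def)
  also have "1 * L2_set (\<lambda>j. norm (?D j y)) UNIV \<le> M"
    using admissible_grad_le[OF H \<Omega>, of y] y closure_subset[of \<Omega>] by (auto simp: L2_set_def)
  finally show "norm (\<Sum>j\<in>UNIV. (w $ j) *\<^sub>R ?D j y) \<le> M" .
qed

text \<open>The bound on the derivatives controls \<open>H\<close> only along paths inside the domain. The cone
  condition supplies one of length at most \<open>5 |x - x0|\<close>: from \<open>x\<close> along the inner normal to
  \<open>x - 2 |x - x0| \<nu>\<close>, which lies in the cone with vertex \<open>x0\<close>, and from there straight to \<open>x0\<close>.\<close>

lemma normal_component_lower_bound:
  fixes H :: "real^'n \<Rightarrow> real^'n"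
  assumes H: "H \<in> admissible \<Omega> x0 M \<delta>0" and \<Omega>: "bounded \<Omega>" and x0: "x0 \<in> closure \<Omega>"
    and \<eta>: "\<eta> \<le> 1 / 3" and M: "M > 0"
  defines "\<nu> \<equiv> outward_normal \<Omega> x0"
  assumes \<nu>: "norm \<nu> = 1"
    and cone: "\<And>x y. x \<in> closure \<Omega> \<Longrightarrow> x \<in> ball x0 r1 \<Longrightarrow> y \<in> ball x0 r1 \<Longrightarrow> y \<noteq> x \<Longrightarrow>
      (y - x) \<bullet> \<nu> \<le> - \<eta> * norm (y - x) \<Longrightarrow> y \<in> \<Omega>"
    and r: "3 * r < r1" "10 * M * r \<le> \<delta>0"
    and x: "x \<in> \<Omega>" "norm (x - x0) \<le> r"
  shows "H x \<bullet> \<nu> \<ge> \<delta>0 / 2"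
proof (cases "x = x0")
  case True
  have "0 \<le> 10 * M * r" using M order_trans[OF norm_ge_zero x(2)] by simp
  moreover have "H x \<bullet> \<nu> > \<delta>0" using H True by (simp add: admissible_def \<nu>_def)
  ultimately show ?thesis using r(2) by simp
next
  case False
  define R where "R = norm (x - x0)"
  define y where "y = x - (2 * R) *\<^sub>R \<nu>"
  have R: "R > 0" "R \<le> r" using False x(2) by (auto simp: R_def)
  have \<nu>\<nu>: "\<nu> \<bullet> \<nu> = 1" using \<nu> by (simp add: norm_eq_1)
  have xc: "x \<in> closure \<Omega>" using x closure_subset by blast
  have yx: "norm (y - x) = 2 * R" using R \<nu> by (simp add: y_def)
  have yx0: "norm (y - x0) \<le> 3 * R"
    using norm_triangle_ineq[of "y - x" "x - x0"] yx by (simp add: R_def)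
  have y0: "(y - x0) \<bullet> \<nu> \<le> - R"
  proof -
    have "(x - x0) \<bullet> \<nu> \<le> R" using norm_cauchy_schwarz[of "x - x0" \<nu>] \<nu> by (simp add: R_def)
    then show ?thesis using \<nu>\<nu> by (simp add: y_def inner_diff_left)
  qed
  then have y_ne: "y \<noteq> x0" using R by auto
  have seg1: "x + t *\<^sub>R (y - x) \<in> \<Omega>" if "0 < t" "t \<le> 1" for t
  proof (rule cone[OF xc])
    have "x + t *\<^sub>R (y - x) - x0 = (x - x0) + t *\<^sub>R (y - x)" by simp
    then have "norm (x + t *\<^sub>R (y - x) - x0) \<le> norm (x - x0) + norm (t *\<^sub>R (y - x))"
      by (simp only: norm_triangle_ineq)
    then have "norm (x + t *\<^sub>R (y - x) - x0) \<le> R + t * (2 * R)"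
      using yx that by (simp add: R_def)
    also have "\<dots> \<le> 3 * R" using mult_right_mono[of t 1 "2 * R"] that R by simp
    finally show "x + t *\<^sub>R (y - x) \<in> ball x0 r1" using R r by (simp add: dist_norm norm_minus_commute)
    have "R < r1" using R r by linarith
    then show "x \<in> ball x0 r1" by (simp add: dist_norm norm_minus_commute R_def)
    show "x + t *\<^sub>R (y - x) \<noteq> x" using that yx R by auto
    have "\<eta> * (t * (2 * R)) \<le> 1 * (t * (2 * R))"
      using that R \<eta> by (intro mult_right_mono) auto
    moreover have "norm (x + t *\<^sub>R (y - x) - x) = t * (2 * R)" using that yx by simp
    moreover have "(x + t *\<^sub>R (y - x) - x) \<bullet> \<nu> = - (t * (2 * R))" using \<nu>\<nu> by (simp add: y_def)
    ultimately show "(x + t *\<^sub>R (y - x) - x) \<bullet> \<nu> \<le> - \<eta> * norm (x + t *\<^sub>R (y - x) - x)"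
      by simp
  qed
  have seg2: "x0 + t *\<^sub>R (y - x0) \<in> \<Omega>" if "0 < t" "t \<le> 1" for t
  proof (rule cone[OF x0])
    have "t * norm (y - x0) \<le> 1 * norm (y - x0)" using that by (intro mult_right_mono) auto
    then show "x0 + t *\<^sub>R (y - x0) \<in> ball x0 r1"
      using R r yx0 that by (simp add: dist_norm)
    show "x0 \<in> ball x0 r1" using R r by simp
    show "x0 + t *\<^sub>R (y - x0) \<noteq> x0" using that y_ne by auto
    have "\<eta> * norm (y - x0) \<le> 1 / 3 * norm (y - x0)" using \<eta> by (intro mult_right_mono) auto
    then have "(y - x0) \<bullet> \<nu> \<le> - (\<eta> * norm (y - x0))" using y0 yx0 by linarith
    then have "t * ((y - x0) \<bullet> \<nu>) \<le> t * (- (\<eta> * norm (y - x0)))"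
      using that by (intro mult_left_mono) auto
    then show "(x0 + t *\<^sub>R (y - x0) - x0) \<bullet> \<nu> \<le> - \<eta> * norm (x0 + t *\<^sub>R (y - x0) - x0)"
      using that by (simp add: mult.left_commute)
  qed
  have yc: "y \<in> closure \<Omega>" using seg1[of 1] closure_subset by auto
  have "\<bar>H y \<bullet> \<nu> - H x \<bullet> \<nu>\<bar> \<le> M * norm (y - x)"
    by (rule admissible_component_lipschitz[OF H \<Omega> \<nu> xc yc]) (simp add: seg1)
  moreover have "\<bar>H y \<bullet> \<nu> - H x0 \<bullet> \<nu>\<bar> \<le> M * norm (y - x0)"
    by (rule admissible_component_lipschitz[OF H \<Omega> \<nu> x0 yc]) (simp add: seg2)
  moreover have "M * norm (y - x) + M * norm (y - x0) \<le> M * (5 * r)"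
    unfolding distrib_left[symmetric] using yx yx0 R M by (intro mult_left_mono) auto
  moreover have "H x0 \<bullet> \<nu> > \<delta>0" using H by (simp add: admissible_def \<nu>_def)
  ultimately show ?thesis using r(2) by (simp add: abs_le_iff)
qed

section \<open>Uniqueness of the vector field near the observation point\<close>

text \<open>Compactness makes the invertibility of the matrix of gradients quantitative.\<close>

lemma gradient_frame_bound:
  fixes A :: "real^'n \<Rightarrow> 'n \<Rightarrow> real^'n"
  assumes C: "compact C" "C \<noteq> {}" and A: "\<And>k. continuous_on C (\<lambda>x. A x k)"
    and det: "\<And>x. x \<in> C \<Longrightarrow> det (\<chi> i k. A x k $ i) \<noteq> 0"
  shows "\<exists>\<kappa>>0. \<forall>x\<in>C. \<forall>w. \<kappa> * (norm w)\<^sup>2 \<le> (\<Sum>k\<in>UNIV. (w \<bullet> A x k)\<^sup>2)"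
proof -
  define F where "F q = (\<Sum>k\<in>UNIV. (snd q \<bullet> A (fst q) k)\<^sup>2)" for q
  have pos: "F (x, w) > 0" if x: "x \<in> C" and w: "w \<noteq> 0" for x w
  proof (rule ccontr)
    assume "\<not> F (x, w) > 0"
    moreover have "F (x, w) \<ge> 0" by (simp add: F_def sum_nonneg)
    ultimately have "F (x, w) = 0" by simp
    then have ortho: "w \<bullet> A x k = 0" for k
      by (simp add: F_def sum_nonneg_eq_0_iff)
    let ?B = "\<chi> i k. A x k $ i"
    have "transpose ?B *v w = 0"
      using ortho by (simp add: vec_eq_iff matrix_vector_mult_def transpose_def inner_vec_def mult.commute)
    moreover have "invertible (transpose ?B)"
      using det[OF x] by (simp add: invertible_det_nz det_transpose)
    ultimately have "w = 0"
      using matrix_left_invertible_ker[of "transpose ?B"] unfolding invertible_def by blast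
    with w show False by simp
  qed
  have "compact (C \<times> sphere (0::real^'n) 1)" using C by (intro compact_Times) auto
  moreover have "C \<times> sphere (0::real^'n) 1 \<noteq> {}"
    using C(2) norm_axis_1 by (auto simp: dist_norm)
  moreover have "continuous_on (C \<times> sphere 0 1) F"
    unfolding F_def
    by (intro continuous_intros continuous_on_compose2[OF A continuous_on_fst[OF continuous_on_id]]) auto
  ultimately obtain q where q: "q \<in> C \<times> sphere 0 1"
    and min: "\<And>q'. q' \<in> C \<times> sphere 0 1 \<Longrightarrow> F q \<le> F q'"
    using continuous_attains_inf[of "C \<times> sphere (0::real^'n) 1" F] by blast
  have "F (fst q, snd q) > 0" using q by (intro pos) auto
  then have "F q > 0" by simp
  moreover have "F q * (norm w)\<^sup>2 \<le> (\<Sum>k\<in>UNIV. (w \<bullet> A x k)\<^sup>2)" if "x \<in> C" for x w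
  proof (cases "w = 0")
    case False
    then have "F q \<le> F (x, w /\<^sub>R norm w)" using that by (intro min) auto
    also have "\<dots> = (\<Sum>k\<in>UNIV. (w \<bullet> A x k)\<^sup>2) / (norm w)\<^sup>2"
      by (simp add: F_def power_mult_distrib sum_distrib_left[symmetric] divide_inverse power_inverse mult.commute)
    finally show ?thesis using False by (simp add: pos_le_divide_eq)
  qed simp
  ultimately show ?thesis by blast
qed

text \<open>The maximum principle bounds the weighted differences \<open>z k\<close> of the time derivatives by the
  weighted maximum \<open>\<mu>\<close> of \<open>|H2 - H1|\<close> times a constant over \<open>s c - P\<close>; at time zero the \<open>z k\<close> are
  the products of \<open>H2 - H1\<close> with the gradients of the \<open>a k\<close> and so bound \<open>\<mu>\<close> in turn.
  The hypotheses \<open>flat\<close> and \<open>growth\<close> on \<open>\<psi> x = (x - x0) \<bullet> \<nu> - \<theta> |x - x0|\<close> say that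
  the part of the closed domain near \<open>x0\<close> where \<open>\<psi> \<ge> -\<epsilon>\<close> has diameter of order \<open>\<epsilon>\<close>, and that \<open>\<psi>\<close> grows at
  rate at least \<open>2 c\<close> along \<open>H1\<close>. Hence \<open>\<phi> (x, t) = \<psi> x - c t\<close> grows at rate \<open>c\<close> in the
  direction \<open>(H1 x, 1)\<close>, and \<open>\<phi> \<ge> -\<epsilon>\<close> forces \<open>t < T\<close>.\<close>

lemma vector_fields_agree:
  fixes \<Omega> :: "(real^'n) set" and H1 H2 :: "real^'n \<Rightarrow> real^'n" and a :: "'n \<Rightarrow> real^'n \<Rightarrow> real"
  assumes \<Omega>: "open \<Omega>" "bounded \<Omega>" and T: "T > 0"
    and p: "continuous_on (closure \<Omega>) p"
    and a: "\<And>k. C1_closure \<Omega> (a k)"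
    and det: "\<And>x. x \<in> closure \<Omega> \<Longrightarrow> det (\<chi> i k. grad_on \<Omega> (a k) x $ i) \<noteq> 0"
    and H: "continuous_on (closure \<Omega>) H1" "continuous_on (closure \<Omega>) H2"
    and sol1: "\<And>k. is_solution \<Omega> T p H1 (a k) (u1 k)"
    and C1: "\<And>k. C1_closure (cylinder \<Omega> T) (dt \<Omega> T (u1 k))"
    and sol2: "\<And>k. is_solution \<Omega> T p H2 (a k) (u2 k)"
    and C2: "\<And>k. C1_closure (cylinder \<Omega> T) (dt \<Omega> T (u2 k))"
    and \<theta>: "\<theta> > 0" and c: "c > 0" and \<epsilon>: "\<epsilon> < c * T" "2 * \<epsilon> < \<theta> * r"
    and flat: "\<And>x. x \<in> closure \<Omega> \<Longrightarrow> norm (x - x0) \<le> r \<Longrightarrow> (x - x0) \<bullet> \<nu> \<le> \<theta> / 2 * norm (x - x0)"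
    and growth: "\<And>x. x \<in> \<Omega> \<Longrightarrow> norm (x - x0) \<le> r \<Longrightarrow> H1 x \<bullet> \<nu> \<ge> \<theta> * norm (H1 x) + 2 * c"
    and observed: "\<And>k x t. x \<in> frontier \<Omega> \<Longrightarrow> norm (x - x0) \<le> r \<Longrightarrow> 0 < t \<Longrightarrow> t < T \<Longrightarrow>
      u1 k (x, t) = u2 k (x, t)"
    and x: "x \<in> closure \<Omega>" "norm (x - x0) \<le> r" "(x - x0) \<bullet> \<nu> - \<theta> * norm (x - x0) \<ge> - \<epsilon>"
  shows "H1 x = H2 x"
proof -
  define \<psi> where "\<psi> x = (x - x0) \<bullet> \<nu> - \<theta> * norm (x - x0)" for x
  define \<phi> where "\<phi> q = \<psi> (fst q) - c * snd q" for q :: "(real^'n) \<times> real"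
  define f where "f x = H2 x - H1 x" for x
  define K1 where "K1 k = grad_on (cylinder \<Omega> T) (dt \<Omega> T (u1 k))" for k
  define K2 where "K2 k = grad_on (cylinder \<Omega> T) (dt \<Omega> T (u2 k))" for k
  define z where "z k q = dt \<Omega> T (u1 k) q - dt \<Omega> T (u2 k) q" for k q
  define Q where "Q = closure (cylinder \<Omega> T) \<inter> {q. norm (fst q - x0) \<le> r \<and> - \<epsilon> \<le> \<phi> q}"
  define Q0 where "Q0 = closure \<Omega> \<inter> {x. norm (x - x0) \<le> r \<and> - \<epsilon> \<le> \<psi> x}"
  note cl = closure_cylinder[OF T, of \<Omega>]
  have comp: "compact (closure \<Omega>)" "compact (closure (cylinder \<Omega> T))"
    using \<Omega> by (auto simp: cl intro!: compact_Times)
  have K1: "is_grad_on (cylinder \<Omega> T) (dt \<Omega> T (u1 k)) (K1 k)"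
    and K2: "is_grad_on (cylinder \<Omega> T) (dt \<Omega> T (u2 k)) (K2 k)" for k
    unfolding K1_def K2_def using is_grad_on_grad_on C1 C2 by blast+
  have vc: "continuous_on (closure (cylinder \<Omega> T)) (dt \<Omega> T (u1 k))"
    "continuous_on (closure (cylinder \<Omega> T)) (dt \<Omega> T (u2 k))" for k
    using C1 C2 by (auto simp: C1_closure_def)
  have zc: "continuous_on (closure (cylinder \<Omega> T)) (z k)" for k
    unfolding z_def using vc by (intro continuous_intros)
  have fc: "continuous_on (closure \<Omega>) f"
    unfolding f_def using H by (intro continuous_intros)
  have Q_compact: "compact Q"
    unfolding Q_def \<phi>_def \<psi>_def
    by (intro compact_Int_closed comp closed_Collect_conj closed_Collect_le continuous_intros)
  have Q0_compact: "compact Q0"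
    unfolding Q0_def \<psi>_def
    by (intro compact_Int_closed comp closed_Collect_conj closed_Collect_le continuous_intros)

  have "\<exists>P\<ge>0. \<forall>x\<in>closure \<Omega>. \<bar>p x\<bar> \<le> P"
    using compact_imp_bounded[OF compact_continuous_image[OF p comp(1)]]
    by (auto simp: bounded_pos intro: less_imp_le)
  then obtain P where P: "P \<ge> 0" "\<And>x. x \<in> closure \<Omega> \<Longrightarrow> \<bar>p x\<bar> \<le> P" by blast
  have "\<exists>N\<ge>0. \<forall>q\<in>closure (cylinder \<Omega> T). norm (fst (K2 k q)) \<le> N" for k
  proof -
    have "continuous_on (closure (cylinder \<Omega> T)) (\<lambda>q. fst (K2 k q))"
      using K2 by (intro continuous_intros) (auto simp: is_grad_on_def)
    from compact_imp_bounded[OF compact_continuous_image[OF this comp(2)]]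
    show ?thesis by (auto simp: bounded_pos intro: less_imp_le)
  qed
  then obtain Nk where Nk: "\<And>k. Nk k \<ge> 0"
    "\<And>k q. q \<in> closure (cylinder \<Omega> T) \<Longrightarrow> norm (fst (K2 k q)) \<le> Nk k" by metis
  define N where "N = (\<Sum>k\<in>UNIV. Nk k)"
  have "Nk k \<le> N" for k
    unfolding N_def using Nk(1) by (intro member_le_sum) auto
  then have N: "N \<ge> 0" "\<And>k q. q \<in> closure (cylinder \<Omega> T) \<Longrightarrow> norm (fst (K2 k q)) \<le> N"
    using Nk order_trans unfolding N_def by (auto intro: sum_nonneg) blast
  have "\<exists>\<kappa>>0. \<forall>x\<in>closure \<Omega>. \<forall>w. \<kappa> * (norm w)\<^sup>2 \<le> (\<Sum>k\<in>UNIV. (w \<bullet> grad_on \<Omega> (a k) x)\<^sup>2)"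
    using comp(1) x(1) is_grad_on_grad_on[OF a] det
    by (intro gradient_frame_bound) (auto simp: is_grad_on_def)
  then obtain \<kappa> where \<kappa>: "\<kappa> > 0"
    "\<And>x w. x \<in> closure \<Omega> \<Longrightarrow> \<kappa> * (norm w)\<^sup>2 \<le> (\<Sum>k\<in>UNIV. (w \<bullet> grad_on \<Omega> (a k) x)\<^sup>2)"
    by blast

  have initial: "z k (x, 0) = f x \<bullet> grad_on \<Omega> (a k) x" if "x \<in> closure \<Omega>" for k x
  proof -
    have "continuous_on (closure \<Omega>) (\<lambda>x. z k (x, 0))"
      by (rule continuous_on_compose2[OF zc]) (use T in \<open>auto simp: cl intro!: continuous_intros\<close>)
    moreover have "continuous_on (closure \<Omega>) (grad_on \<Omega> (a k))"
      using is_grad_on_grad_on[OF a] by (simp add: is_grad_on_def)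
    ultimately have "continuous_on (closure \<Omega>) (\<lambda>x. z k (x, 0) - f x \<bullet> grad_on \<Omega> (a k) x)"
      using fc by (intro continuous_intros)
    moreover have "z k (x, 0) - f x \<bullet> grad_on \<Omega> (a k) x = 0" if "x \<in> \<Omega>" for x
      using initial_dt[OF sol1 \<Omega>(1) T that a] initial_dt[OF sol2 \<Omega>(1) T that a]
      by (simp add: z_def f_def inner_diff_left)
    ultimately have "z k (x, 0) - f x \<bullet> grad_on \<Omega> (a k) x = 0"
      using continuous_constant_on_closure that by blast
    then show ?thesis by simp
  qed

  \<comment> \<open>The final estimate reads \<open>\<kappa> \<mu>\<^sup>2 \<le> n (N \<mu> / (s c - P))\<^sup>2\<close>; the choice of \<open>s\<close> makes
    \<open>s c - P\<close> exceed \<open>R\<close>, where \<open>\<kappa> R\<^sup>2 = n N\<^sup>2\<close>.\<close>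
  define n where "n = real CARD('n)"
  define R where "R = sqrt (n * N\<^sup>2 / \<kappa>)"
  define s where "s = (P + 1 + R) / c"
  have R: "R \<ge> 0" "R\<^sup>2 = n * N\<^sup>2 / \<kappa>" using \<kappa>(1) by (simp_all add: R_def n_def)
  have sc: "s * c - P = 1 + R" using c by (simp add: s_def)
  have s: "P < s * c" "s > 0" using sc R(1) P(1) c by (auto simp: s_def intro!: divide_pos_pos)
  obtain m where m: "m \<in> Q0"
    and max: "\<And>x. x \<in> Q0 \<Longrightarrow> exp (s * \<psi> x) * norm (f x) \<le> exp (s * \<psi> m) * norm (f m)"
  proof -
    have "continuous_on Q0 (\<lambda>x. exp (s * \<psi> x) * norm (f x))"
      unfolding \<psi>_def using continuous_on_subset[OF fc, of Q0]
      by (intro continuous_intros) (auto simp: Q0_def)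
    moreover have "Q0 \<noteq> {}" using x by (auto simp: Q0_def \<psi>_def)
    ultimately show ?thesis using continuous_attains_sup[OF Q0_compact] that by blast
  qed
  define \<mu> where "\<mu> = exp (s * \<psi> m) * norm (f m)"
  have \<mu>0: "\<mu> \<ge> 0" by (simp add: \<mu>_def)

  have estimate: "exp (s * \<phi> q) * \<bar>z k q\<bar> \<le> (N * \<mu>) / (s * c - P)" if "q \<in> Q" for k q
  proof (rule weighted_maximum_principle[OF Q_compact _ _ s _ _ that])
    show "continuous_on Q \<phi>" unfolding \<phi>_def \<psi>_def by (intro continuous_intros)
    show "continuous_on Q (z k)" using zc by (rule continuous_on_subset) (auto simp: Q_def)
    show "0 \<le> N * \<mu>" using N \<mu>0 by simp
    fix q assume q: "q \<in> Q" and zq: "z k q \<noteq> 0"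
    obtain y t where yt: "q = (y, t)" by (cases q)
    have y: "y \<in> closure \<Omega>" "norm (y - x0) \<le> r" and t: "0 \<le> t" "t \<le> T"
      and \<phi>q: "- \<epsilon> \<le> \<psi> y - c * t"
      using q by (auto simp: Q_def yt cl \<phi>_def)
    have y\<Omega>: "y \<in> \<Omega>"
    proof (rule ccontr)
      assume "y \<notin> \<Omega>"
      then have "y \<in> frontier \<Omega>" using y \<Omega> by (simp add: frontier_def interior_open)
      then have "dt \<Omega> T (u1 k) (y, t) = dt \<Omega> T (u2 k) (y, t)"
        using observed y sol1 sol2 t
        by (intro dt_eq_on_boundary[OF _ _ T]) (auto simp: is_solution_def)
      then show False using zq by (simp add: z_def yt)
    qed
    have ct: "c * t \<ge> 0" using c t by simp
    have "\<psi> y \<le> - (\<theta> / 2 * norm (y - x0))"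
      using flat[OF y] by (simp add: \<psi>_def field_simps)
    moreover have "0 \<le> \<theta> / 2 * norm (y - x0)" using \<theta> by simp
    ultimately have "c * t < c * T" "\<theta> * norm (y - x0) < \<theta> * r"
      using \<phi>q \<epsilon> ct by linarith+
    then have tT: "t < T" and yr: "norm (y - x0) < r" using c \<theta> by auto
    define d where "d = (H1 y, 1::real)"

    have "((\<lambda>h. y + h *\<^sub>R H1 y) \<longlongrightarrow> y + 0 *\<^sub>R H1 y) (at_right 0)"
      by (intro tendsto_intros)
    then have "\<forall>\<^sub>F h in at_right 0. y + h *\<^sub>R H1 y \<in> \<Omega> \<inter> ball x0 r"
      using y\<Omega> yr \<Omega>(1) by (intro topological_tendstoD) (auto simp: dist_norm norm_minus_commute)
    moreover have "\<forall>\<^sub>F h in at_right (0::real). h < T - t"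
      using tT by (intro order_tendstoD(2)[OF tendsto_ident_at]) auto
    ultimately have ev: "\<forall>\<^sub>F h in at_right 0. 0 < h \<and> y + h *\<^sub>R H1 y \<in> \<Omega> \<inter> ball x0 r \<and> h < T - t"
      using eventually_at_right_less by eventually_elim auto
    have "\<forall>\<^sub>F h in at_right 0. q + h *\<^sub>R d \<in> Q \<and> \<phi> q + c * h \<le> \<phi> (q + h *\<^sub>R d)"
      using ev
    proof eventually_elim
      case (elim h)
      have "h * (\<theta> * norm (H1 y) + 2 * c) \<le> h * (H1 y \<bullet> \<nu>)"
        using growth[OF y\<Omega> y(2)] elim by (intro mult_left_mono) auto
      moreover have "norm (y + h *\<^sub>R H1 y - x0) \<le> norm (y - x0) + h * norm (H1 y)"
        using norm_triangle_ineq[of "y - x0" "h *\<^sub>R H1 y"] elim by (simp add: algebra_simps)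
      then have "\<theta> * norm (y + h *\<^sub>R H1 y - x0) \<le> \<theta> * (norm (y - x0) + h * norm (H1 y))"
        using \<theta> by (intro mult_left_mono) auto
      moreover have "(y + h *\<^sub>R H1 y - x0) \<bullet> \<nu> = (y - x0) \<bullet> \<nu> + h * (H1 y \<bullet> \<nu>)"
        by (simp add: inner_diff_left inner_add_left)
      ultimately have inc: "\<psi> y + 2 * c * h \<le> \<psi> (y + h *\<^sub>R H1 y)"
        unfolding \<psi>_def by (simp add: algebra_simps)
      then have "\<phi> q + c * h \<le> \<phi> (q + h *\<^sub>R d)"
        by (simp add: \<phi>_def yt d_def algebra_simps)
      moreover have "0 \<le> c * h" using c elim by simp
      ultimately have "- \<epsilon> \<le> \<phi> (q + h *\<^sub>R d)" using \<phi>q by (simp add: \<phi>_def yt)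
      moreover have "y + h *\<^sub>R H1 y \<in> closure \<Omega>" using elim closure_subset by blast
      ultimately show ?case
        using elim t \<open>\<phi> q + c * h \<le> \<phi> (q + h *\<^sub>R d)\<close>
        by (simp add: Q_def yt d_def cl dist_norm norm_minus_commute)
    qed
    moreover
    obtain h0 where h0: "h0 > 0"
      "\<And>h. 0 < h \<Longrightarrow> h < h0 \<Longrightarrow> y + h *\<^sub>R H1 y \<in> \<Omega> \<inter> ball x0 r \<and> h < T - t"
      using ev unfolding eventually_at_right_field by blast
    have der: "((\<lambda>h. v (q + h *\<^sub>R d)) has_real_derivative d \<bullet> K q) (at 0 within {0..})"
      if "continuous_on (closure (cylinder \<Omega> T)) v" "is_grad_on (cylinder \<Omega> T) v K" for v K
    proof (rule one_sided_derivative[OF that tendsto_const h0(1)])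
      show "q + 0 + h *\<^sub>R d \<in> cylinder \<Omega> T" if "0 < h" "h < h0" for h
        using h0(2)[OF that] that t by (simp add: yt d_def)
    qed
    have "((\<lambda>h. z k (q + h *\<^sub>R d)) has_real_derivative d \<bullet> K1 k q - d \<bullet> K2 k q) (at 0 within {0..})"
      unfolding z_def by (intro DERIV_diff der vc K1 K2)
    moreover have "exp (s * \<phi> q) * \<bar>d \<bullet> K1 k q - d \<bullet> K2 k q\<bar>
        \<le> N * \<mu> + P * (exp (s * \<phi> q) * \<bar>z k q\<bar>)"
    proof -
      have "d \<bullet> K1 k q - d \<bullet> K2 k q = - p y * z k q + f y \<bullet> fst (K2 k q)"
        using dt_equation_closed[OF sol1 \<Omega>(1) T y\<Omega> C1 t, of k]
          dt_equation_closed[OF sol2 \<Omega>(1) T y\<Omega> C2 t, of k]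
        by (simp add: K1_def K2_def d_def yt z_def f_def inner_prod_def algebra_simps)
      also have "\<bar>\<dots>\<bar> \<le> \<bar>p y\<bar> * \<bar>z k q\<bar> + norm (f y) * norm (fst (K2 k q))"
        using Cauchy_Schwarz_ineq2[of "f y" "fst (K2 k q)"]
        by (intro order_trans[OF abs_triangle_ineq] add_mono) (auto simp: abs_mult)
      also have "\<dots> \<le> P * \<bar>z k q\<bar> + norm (f y) * N"
        using P(2)[OF y(1)] N(2)[of q k] q
        by (intro add_mono mult_right_mono mult_left_mono) (auto simp: Q_def)
      finally have "exp (s * \<phi> q) * \<bar>d \<bullet> K1 k q - d \<bullet> K2 k q\<bar>
          \<le> exp (s * \<phi> q) * (P * \<bar>z k q\<bar> + norm (f y) * N)"
        by (intro mult_left_mono) auto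
      moreover have "exp (s * \<phi> q) * norm (f y) \<le> \<mu>"
      proof -
        have "exp (s * \<phi> q) * norm (f y) \<le> exp (s * \<psi> y) * norm (f y)"
          using ct s(2) by (intro mult_right_mono) (auto simp: \<phi>_def yt)
        also have "\<dots> \<le> \<mu>"
          unfolding \<mu>_def using y \<phi>q ct by (intro max) (auto simp: Q0_def)
        finally show ?thesis .
      qed
      then have "N * (exp (s * \<phi> q) * norm (f y)) \<le> N * \<mu>" using N(1) by (rule mult_left_mono)
      ultimately show ?thesis by (simp add: algebra_simps)
    qed
    ultimately show "\<exists>d z'. (\<forall>\<^sub>F h in at_right 0. q + h *\<^sub>R d \<in> Q \<and> \<phi> q + c * h \<le> \<phi> (q + h *\<^sub>R d)) \<and>
        ((\<lambda>h. z k (q + h *\<^sub>R d)) has_real_derivative z') (at 0 within {0..}) \<and>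
        exp (s * \<phi> q) * \<bar>z'\<bar> \<le> N * \<mu> + P * (exp (s * \<phi> q) * \<bar>z k q\<bar>)"
      by blast
  qed

  have m': "m \<in> closure \<Omega>" "(m, 0) \<in> Q" using m T by (auto simp: Q_def Q0_def cl \<phi>_def)
  have "\<kappa> * \<mu>\<^sup>2 = (exp (s * \<psi> m))\<^sup>2 * (\<kappa> * (norm (f m))\<^sup>2)"
    by (simp add: \<mu>_def power_mult_distrib)
  also have "\<dots> \<le> (exp (s * \<psi> m))\<^sup>2 * (\<Sum>k\<in>UNIV. (f m \<bullet> grad_on \<Omega> (a k) m)\<^sup>2)"
    by (intro mult_left_mono \<kappa>(2) m') auto
  also have "\<dots> = (\<Sum>k\<in>UNIV. (exp (s * \<phi> (m, 0)) * \<bar>z k (m, 0)\<bar>)\<^sup>2)"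
    by (simp add: initial[OF m'(1)] \<phi>_def power_mult_distrib sum_distrib_left)
  also have "\<dots> \<le> (\<Sum>k\<in>(UNIV::'n set). (N * \<mu> / (s * c - P))\<^sup>2)"
    by (intro sum_mono power_mono estimate m') auto
  also have "\<dots> = n * N\<^sup>2 * \<mu>\<^sup>2 / (1 + R)\<^sup>2"
    unfolding sc by (simp add: n_def power_mult_distrib power_divide)
  also have "n * N\<^sup>2 = \<kappa> * R\<^sup>2" using R(2) \<kappa>(1) by simp
  finally have "\<kappa> * \<mu>\<^sup>2 * (1 + R)\<^sup>2 \<le> \<kappa> * R\<^sup>2 * \<mu>\<^sup>2"
    using R(1) by (simp add: pos_le_divide_eq)
  then have "(\<kappa> * (1 + 2 * R)) * \<mu>\<^sup>2 \<le> 0"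
    by (simp add: power2_sum algebra_simps)
  then have "\<mu> = 0"
    using \<kappa>(1) R(1) by (simp add: mult_le_0_iff)
  moreover have "x \<in> Q0" using x by (simp add: Q0_def \<psi>_def)
  ultimately have "exp (s * \<psi> x) * norm (f x) \<le> 0" using max unfolding \<mu>_def by metis
  then have "f x = 0" by (simp add: mult_le_0_iff)
  then show ?thesis by (simp add: f_def)
qed

theorem mainTheorem3:
  fixes \<Omega> \<Gamma> :: "(real^'n) set" and x0 :: "real^'n" and T \<delta>0 M :: real
    and p :: "real^'n \<Rightarrow> real" and a :: "'n \<Rightarrow> real^'n \<Rightarrow> real"
  assumes "bounded_smooth_domain \<Omega>"
    and "openin (top_of_set (frontier \<Omega>)) \<Gamma>" and "\<Gamma> \<noteq> {}"
    and "x0 \<in> \<Gamma>"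
    and "T > 0" and "\<delta>0 > 0" and "M > 0"
    and "continuous_on (closure \<Omega>) p"
    and "\<And>k. C1_closure \<Omega> (a k)"
    and "\<And>x. x \<in> closure \<Omega> \<Longrightarrow> \<bar>det (\<chi> i k. grad_on \<Omega> (a k) x $ i)\<bar> \<noteq> 0"
  shows "\<exists>D. open D \<and> connected D \<and> D \<noteq> {} \<and> D \<subseteq> \<Omega> \<and>
    x0 \<in> frontier D \<inter> frontier \<Omega> \<and> frontier D \<inter> frontier \<Omega> \<subseteq> \<Gamma> \<and>
    (\<forall>H1 H2 u1 u2.
      H1 \<in> admissible \<Omega> x0 M \<delta>0 \<and> H2 \<in> admissible \<Omega> x0 M \<delta>0 \<and>
      (\<forall>k. is_solution \<Omega> T p H1 (a k) (u1 k) \<and> C1_closure (cylinder \<Omega> T) (dt \<Omega> T (u1 k))) \<and>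
      (\<forall>k. is_solution \<Omega> T p H2 (a k) (u2 k) \<and> C1_closure (cylinder \<Omega> T) (dt \<Omega> T (u2 k))) \<and>
      (\<forall>k. \<forall>x\<in>\<Gamma>. \<forall>t\<in>{0<..<T}. u1 k (x, t) = u2 k (x, t))
      \<longrightarrow> (\<forall>x\<in>D. H1 x = H2 x))"
proof -
  have op: "open \<Omega>" and bd: "bounded \<Omega>" using assms(1) by (auto simp: bounded_smooth_domain_def)
  have fr: "x0 \<in> frontier \<Omega>" using assms(2,4) openin_subset by fastforce
  then have x0c: "x0 \<in> closure \<Omega>" and x0n: "x0 \<notin> \<Omega>"
    using op by (auto simp: frontier_def interior_open)
  define \<nu> where "\<nu> = outward_normal \<Omega> x0"
  define \<theta> where "\<theta> = \<delta>0 / (4 * M)"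
  define c where "c = \<delta>0 / 8"
  define \<eta> where "\<eta> = min (\<theta> / 2) (1 / 3)"
  have pos: "\<theta> > 0" "c > 0" "\<eta> > 0" using assms(6,7) by (auto simp: \<theta>_def c_def \<eta>_def)
  note cone = inward_cone[OF assms(1) fr pos(3), folded \<nu>_def]
  have \<nu>\<nu>: "\<nu> \<bullet> \<nu> = 1" using cone(1) by (simp add: norm_eq_1)
  obtain r1 where r1: "r1 > 0"
    and in\<Omega>: "\<And>x y. x \<in> closure \<Omega> \<Longrightarrow> x \<in> ball x0 r1 \<Longrightarrow> y \<in> ball x0 r1 \<Longrightarrow> y \<noteq> x \<Longrightarrow>
      (y - x) \<bullet> \<nu> \<le> - \<eta> * norm (y - x) \<Longrightarrow> y \<in> \<Omega>"
    using cone(2) by blast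
  obtain r2 where r2: "r2 > 0" "ball x0 r2 \<inter> frontier \<Omega> \<subseteq> \<Gamma>"
    using assms(2,4) unfolding openin_contains_ball by blast
  define r where "r = min (min (r1 / 4) (r2 / 2)) (\<delta>0 / (10 * M))"
  have r: "r > 0" "3 * r < r1" "r < r2" using r1 r2 assms(6,7) by (auto simp: r_def min_less_iff_disj)
  have "r \<le> \<delta>0 / (10 * M)" by (simp add: r_def)
  then have rM: "10 * M * r \<le> \<delta>0" using assms(7) by (simp add: pos_le_divide_eq algebra_simps)
  define \<epsilon> where "\<epsilon> = min (c * T / 2) (\<theta> * r / 4)"
  have \<epsilon>: "\<epsilon> > 0" using pos r assms(5) by (simp add: \<epsilon>_def)
  have "\<epsilon> \<le> c * T / 2" "\<epsilon> \<le> \<theta> * r / 4" "c * T > 0" "\<theta> * r > 0"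
    using pos r assms(5) by (simp_all add: \<epsilon>_def)
  then have \<epsilon>': "\<epsilon> < c * T" "2 * \<epsilon> < \<theta> * r" by linarith+
  define r' where "r' = min r (\<epsilon> / (1 + \<theta>))"
  have r': "r' > 0" "r' \<le> r" using r \<epsilon> pos by (auto simp: r'_def)

  \<comment> \<open>A point of the closed domain violating the bound would have \<open>x0\<close> in its inward cone.\<close>
  have flat: "(x - x0) \<bullet> \<nu> \<le> \<theta> / 2 * norm (x - x0)" if "x \<in> closure \<Omega>" "norm (x - x0) \<le> r" for x
  proof (rule ccontr)
    assume *: "\<not> ?thesis"
    have "\<eta> * norm (x - x0) \<le> \<theta> / 2 * norm (x - x0)"
      by (intro mult_right_mono) (auto simp: \<eta>_def)
    with * have "(x0 - x) \<bullet> \<nu> \<le> - \<eta> * norm (x0 - x)"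
      by (simp add: inner_diff_left norm_minus_commute)
    moreover have "x0 \<noteq> x" using * by auto
    ultimately have "x0 \<in> \<Omega>"
      using that r r1 by (intro in\<Omega>[OF that(1)]) (auto simp: dist_norm norm_minus_commute)
    with x0n show False ..
  qed

  define y where "y s = x0 - s *\<^sub>R \<nu>" for s
  have y: "y s \<in> \<Omega> \<inter> ball x0 r'" if "0 < s" "s < r'" for s
  proof
    show "y s \<in> ball x0 r'" using that cone(1) by (simp add: y_def dist_norm)
    show "y s \<in> \<Omega>"
    proof (rule in\<Omega>[OF x0c])
      show "y s \<in> ball x0 r1" using that cone(1) r r' by (simp add: y_def dist_norm)
      have "\<eta> * s \<le> 1 * s" using that by (intro mult_right_mono) (auto simp: \<eta>_def)
      then show "(y s - x0) \<bullet> \<nu> \<le> - \<eta> * norm (y s - x0)"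
        using that cone(1) \<nu>\<nu> by (simp add: y_def)
    qed (use that cone(1) r1 in \<open>auto simp: y_def\<close>)
  qed
  define D where "D = connected_component_set (\<Omega> \<inter> ball x0 r') (y (r' / 2))"
  have D_sub: "D \<subseteq> \<Omega> \<inter> ball x0 r'" unfolding D_def by (rule connected_component_subset)
  have yD: "y s \<in> D" if "0 < s" "s < r'" for s
  proof -
    have "connected (y ` {0<..<r'})"
      unfolding y_def by (intro connected_continuous_image continuous_intros connected_Ioo)
    moreover have "y ` {0<..<r'} \<subseteq> \<Omega> \<inter> ball x0 r'" using y by auto
    moreover have "y (r' / 2) \<in> y ` {0<..<r'}" using r' by auto
    ultimately have "y ` {0<..<r'} \<subseteq> D"
      unfolding D_def by (intro connected_component_maximal)
    then show ?thesis using that by auto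
  qed
  have D_open: "open D" unfolding D_def using op by (intro open_connected_component) auto
  have D_conn: "connected D" unfolding D_def by simp
  have D_ne: "D \<noteq> {}" using yD[of "r' / 2"] r' by auto
  have "(y \<longlongrightarrow> y 0) (at_right 0)" unfolding y_def by (intro tendsto_intros)
  moreover have "\<forall>\<^sub>F s in at_right 0. y s \<in> closure D"
    using eventually_at_right_real[OF r'(1)]
    by eventually_elim (use yD closure_subset in auto)
  ultimately have "y 0 \<in> closure D"
    by (intro Lim_in_closed_set[OF closed_closure]) auto
  then have x0D: "x0 \<in> frontier D"
    using D_sub x0n D_open by (auto simp: frontier_def interior_open y_def)
  have D_cl: "closure D \<subseteq> cball x0 r'"
    using D_sub by (intro closure_minimal) auto
  have D_\<Gamma>: "frontier D \<inter> frontier \<Omega> \<subseteq> \<Gamma>"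
  proof -
    have "cball x0 r' \<subseteq> ball x0 r2" using r r' by auto
    moreover have "frontier D \<subseteq> closure D" by (simp add: frontier_def)
    ultimately show ?thesis using D_cl r2(2) by blast
  qed

  have agree: "H1 x = H2 x" if H1: "H1 \<in> admissible \<Omega> x0 M \<delta>0" and H2: "H2 \<in> admissible \<Omega> x0 M \<delta>0"
    and sol1: "\<And>k. is_solution \<Omega> T p H1 (a k) (u1 k) \<and> C1_closure (cylinder \<Omega> T) (dt \<Omega> T (u1 k))"
    and sol2: "\<And>k. is_solution \<Omega> T p H2 (a k) (u2 k) \<and> C1_closure (cylinder \<Omega> T) (dt \<Omega> T (u2 k))"
    and eq: "\<And>k x t. x \<in> \<Gamma> \<Longrightarrow> t \<in> {0<..<T} \<Longrightarrow> u1 k (x, t) = u2 k (x, t)"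
    and x: "x \<in> D" for H1 H2 u1 u2 x
  proof (rule vector_fields_agree[where \<Omega> = \<Omega> and T = T and p = p and a = a and r = r and
        \<theta> = \<theta> and c = c and \<epsilon> = \<epsilon> and \<nu> = \<nu> and ?x0.0 = x0 and ?u1.0 = u1
        and ?u2.0 = u2 and ?H1.0 = H1 and ?H2.0 = H2 and x = x])
    show "det (\<chi> i k. grad_on \<Omega> (a k) x $ i) \<noteq> 0" if "x \<in> closure \<Omega>" for x
      using assms(10)[OF that] by simp
    show "continuous_on (closure \<Omega>) H1" "continuous_on (closure \<Omega>) H2"
      using H1 H2 by (auto intro: admissible_continuous)
    show "(x - x0) \<bullet> \<nu> \<le> \<theta> / 2 * norm (x - x0)" if "x \<in> closure \<Omega>" "norm (x - x0) \<le> r" for x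
      using flat that .
    show "\<theta> * norm (H1 x) + 2 * c \<le> H1 x \<bullet> \<nu>" if x: "x \<in> \<Omega>" "norm (x - x0) \<le> r" for x
    proof -
      have "\<delta>0 / 2 \<le> H1 x \<bullet> \<nu>"
        unfolding \<nu>_def
        by (rule normal_component_lower_bound[OF H1 bd x0c _ assms(7) _ _ r(2) rM x, where \<eta> = \<eta>])
          (use in\<Omega> cone(1) in \<open>auto simp: \<eta>_def \<nu>_def\<close>)
      moreover have "norm (H1 x) \<le> M"
        using x closure_subset by (intro admissible_norm_le[OF H1 bd]) auto
      then have "\<theta> * norm (H1 x) \<le> \<theta> * M" using pos by (intro mult_left_mono) auto
      moreover have "\<theta> * M = \<delta>0 / 4" using assms(7) by (simp add: \<theta>_def)
      ultimately show ?thesis by (simp add: c_def)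
    qed
    show "u1 k (x, t) = u2 k (x, t)" if "x \<in> frontier \<Omega>" "norm (x - x0) \<le> r" "0 < t" "t < T" for k x t
      using that r2(2) r by (intro eq) (auto simp: dist_norm norm_minus_commute)
    have x': "x \<in> \<Omega>" "norm (x - x0) < r'" using x D_sub by (auto simp: dist_norm norm_minus_commute)
    show "x \<in> closure \<Omega>" using x' closure_subset by blast
    show "norm (x - x0) \<le> r" using x' r' by simp
    have "norm (x - x0) \<le> \<epsilon> / (1 + \<theta>)" using x' by (simp add: r'_def)
    then have "norm (x - x0) * (1 + \<theta>) \<le> \<epsilon>" using pos by (simp add: pos_le_divide_eq)
    moreover have "- norm (x - x0) \<le> (x - x0) \<bullet> \<nu>"
      using Cauchy_Schwarz_ineq2[of "x - x0" \<nu>] cone(1) by simp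
    ultimately show "- \<epsilon> \<le> (x - x0) \<bullet> \<nu> - \<theta> * norm (x - x0)"
      by (simp add: algebra_simps)
  qed (use assms op bd sol1 sol2 pos \<epsilon>' in auto)

  have D: "open D \<and> connected D \<and> D \<noteq> {} \<and> D \<subseteq> \<Omega> \<and>
      x0 \<in> frontier D \<inter> frontier \<Omega> \<and> frontier D \<inter> frontier \<Omega> \<subseteq> \<Gamma>"
    using D_open D_conn D_ne D_sub x0D fr D_\<Gamma> by blast
  show ?thesis
  proof (intro exI[of _ D] conjI allI impI ballI)
    fix H1 H2 u1 u2 x
    assume "H1 \<in> admissible \<Omega> x0 M \<delta>0 \<and> H2 \<in> admissible \<Omega> x0 M \<delta>0 \<and>
      (\<forall>k. is_solution \<Omega> T p H1 (a k) (u1 k) \<and> C1_closure (cylinder \<Omega> T) (dt \<Omega> T (u1 k))) \<and>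
      (\<forall>k. is_solution \<Omega> T p H2 (a k) (u2 k) \<and> C1_closure (cylinder \<Omega> T) (dt \<Omega> T (u2 k))) \<and>
      (\<forall>k. \<forall>x\<in>\<Gamma>. \<forall>t\<in>{0<..<T}. u1 k (x, t) = u2 k (x, t))" and "x \<in> D"
    then show "H1 x = H2 x" by (intro agree[where ?H1.0 = H1 and ?H2.0 = H2 and ?u1.0 = u1 and ?u2.0 = u2]) auto
  qed (use D in auto)
qed

end
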